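(* Consider a sequence of community detection problems with fixed expected total degree, indexed by $N\to\infty$, with parameters $n,p_0',p_1$ (depending on $N$) satisfying the standing assumptions of the context. Assume that there is a constant $C>0$ with $p_0\ge C/N$. If $$\frac{(p_1-p_0')^2}{p_0'}\,\frac{n^3}{N^{3/2}}\to\infty ,$$ then the degree variance test is asymptotically powerful under fixed expected total degree: there is a sequence of thresholds $t_N$ such that the test $T_N=\mathbf 1\{V^*\ge t_N\}$ satisfies $\gamma_N'(T_N)\to0$, where $V^*$ is the degree variance statistic defined in the context.
   Context: Observed data: the adjacency matrix $\boldsymbol{W}=(W_{i,j})\in\{0,1\}^{N\times N}$ (symmetric, zero diagonal) of a random undirected graph on the node set $\{1,\dots,N\}$. Notation: $m^{(2)}=m(m-1)/2$. Fixed expected total degree model: given $0<p_0'\le p_1<1$, set $p_0:=p_0'+(p_1-p_0')\frac{n^{(2)}}{N^{(2)}}$. Under $\mathbb{P}_0$ (null), the $W_{i,j}$, $i<j$, are i.i.d. Bernoulli$(p_0)$. For $S\subset\{1,\dots,N\}$ with $|S|=n$, under $\mathbb{P}'_S$ (alternative), the $W_{i,j}$, $i<j$, are independent, $\mathbb{P}'_S(W_{i,j}=1)=p_1$ if $i,j\in S$, and $=p_0'$ otherwise. A test $T$ is a function of $\boldsymbol{W}$ with values in $\{0,1\}$, and its risk is $\gamma'_N(T)=\mathbb{P}_0(T=1)+\max_{|S|=n}\mathbb{P}'_S(T=0)$. Degree variance statistic: let $W=\sum_{1\le i<j\le N}W_{i,j}$, $\hat p_0=W/N^{(2)}$, $W_{i\cdot}=\sum_{j\ne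 i}W_{i,j}$, $$V_1=(N-1)\frac{N^{(2)}}{N^{(2)}-1}\hat p_0(1-\hat p_0),\qquad V_2=\frac1{N-2}\sum_{i=1}^N\big(W_{i\cdot}-(N-1)\hat p_0\big)^2,$$ and $V^*=\dfrac{V_2-V_1}{\sqrt N\,\hat p_0}$ (with an arbitrary value, say $0$, when $\hat p_0=0$). Standing assumptions: $N\to\infty$; $n,p_0',p_1$ may depend on $N$; $n/N\to0$; $p_0$ is bounded away from $1$; $N^2p_0\to\infty$; and $n\to\infty$ with $n^2p_1\to\infty$. *)

theory Defs
  imports "HOL-Probability.Probability"
begin

definition num_pairs :: "nat \<Rightarrow> real" where
  "num_pairs m = real m * (real m - 1) / 2"

definition edges :: "nat \<Rightarrow> (nat \<times> nat) set" where
  "edges N = {(i, j). 1 \<le> i \<and> i < j \<and> j \<le> N}"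

definition adjacency :: "(nat \<times> nat \<Rightarrow> bool) \<Rightarrow> nat \<Rightarrow> nat \<Rightarrow> nat" where
  "adjacency e i j =
     (if i < j then of_bool (e (i, j)) else if j < i then of_bool (e (j, i)) else 0)"

text \<open>Law of the adjacency matrix of a random undirected graph on \<open>{1..N}\<close> in which the pairs
  \<open>i < j\<close> are joined independently, with probability \<open>P i j\<close>. Pairs outside \<open>edges N\<close> are never
  joined, so entries with an index outside \<open>{1..N}\<close> vanish.\<close>

definition random_graph :: "nat \<Rightarrow> (nat \<Rightarrow> nat \<Rightarrow> real) \<Rightarrow> (nat \<Rightarrow> nat \<Rightarrow> nat) pmf" where
  "random_graph N P =
     map_pmf adjacency (Pi_pmf (edges N) False (\<lambda>(i, j). bernoulli_pmf (P i j)))"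

definition null_prob :: "nat \<Rightarrow> nat \<Rightarrow> real \<Rightarrow> real \<Rightarrow> real" where
  "null_prob N n p0' p1 = p0' + (p1 - p0') * (num_pairs n / num_pairs N)"

definition null_law :: "nat \<Rightarrow> nat \<Rightarrow> real \<Rightarrow> real \<Rightarrow> (nat \<Rightarrow> nat \<Rightarrow> nat) pmf" where
  "null_law N n p0' p1 = random_graph N (\<lambda>i j. null_prob N n p0' p1)"

definition alt_law :: "nat \<Rightarrow> real \<Rightarrow> real \<Rightarrow> nat set \<Rightarrow> (nat \<Rightarrow> nat \<Rightarrow> nat) pmf" where
  "alt_law N p0' p1 S = random_graph N (\<lambda>i j. if i \<in> S \<and> j \<in> S then p1 else p0')"

text \<open>The maximum is over a nonempty set only if \<open>n \<le> N\<close>.\<close>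

definition risk ::
    "nat \<Rightarrow> nat \<Rightarrow> real \<Rightarrow> real \<Rightarrow> ((nat \<Rightarrow> nat \<Rightarrow> nat) \<Rightarrow> nat) \<Rightarrow> real" where
  "risk N n p0' p1 T =
     measure_pmf.prob (null_law N n p0' p1) {w. T w = 1} +
     (MAX S\<in>{S. S \<subseteq> {1..N} \<and> card S = n}. measure_pmf.prob (alt_law N p0' p1 S) {w. T w = 0})"

definition total_degree :: "nat \<Rightarrow> (nat \<Rightarrow> nat \<Rightarrow> nat) \<Rightarrow> real" where
  "total_degree N w = (\<Sum>(i, j)\<in>edges N. real (w i j))"

definition p0_hat :: "nat \<Rightarrow> (nat \<Rightarrow> nat \<Rightarrow> nat) \<Rightarrow> real" where
  "p0_hat N w = total_degree N w / num_pairs N"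

definition degree :: "nat \<Rightarrow> (nat \<Rightarrow> nat \<Rightarrow> nat) \<Rightarrow> nat \<Rightarrow> real" where
  "degree N w i = (\<Sum>j\<in>{1..N} - {i}. real (w i j))"

definition V1 :: "nat \<Rightarrow> (nat \<Rightarrow> nat \<Rightarrow> nat) \<Rightarrow> real" where
  "V1 N w =
     (real N - 1) * (num_pairs N / (num_pairs N - 1)) * p0_hat N w * (1 - p0_hat N w)"

definition V2 :: "nat \<Rightarrow> (nat \<Rightarrow> nat \<Rightarrow> nat) \<Rightarrow> real" where
  "V2 N w =
     1 / (real N - 2) * (\<Sum>i\<in>{1..N}. (degree N w i - (real N - 1) * p0_hat N w)\<^sup>2)"

definition V_star :: "nat \<Rightarrow> (nat \<Rightarrow> nat \<Rightarrow> nat) \<Rightarrow> real" where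
  "V_star N w =
     (if p0_hat N w = 0 then 0 else (V2 N w - V1 N w) / (sqrt (real N) * p0_hat N w))"

definition degree_variance_test :: "nat \<Rightarrow> real \<Rightarrow> (nat \<Rightarrow> nat \<Rightarrow> nat) \<Rightarrow> nat" where
  "degree_variance_test N t w = (if V_star N w \<ge> t then 1 else 0)"

end

theory Submission
  imports Defs
begin

text \<open>The difference \<open>V\<^sub>2 - V\<^sub>1\<close> is a quadratic form in the edge indicators whose kernel vanishes on
  the diagonal and has zero row sums. After centring the indicators it is therefore a constant plus
  a linear and an off-diagonal quadratic form in independent centred variables, and these two forms
  are uncorrelated. With \<open>D = p\<^sub>1 - p\<^sub>0'\<close> and \<open>s = n\<^sup>3 D\<^sup>2 / N\<close>, the constant is \<open>0\<close> under the null
  and at least \<open>s / 8\<close> under every alternative, while the second moment of the fluctuation is at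
  most \<open>36 N p\<^sub>0\<^sup>2\<close> under the null and
  \<open>36 N p\<^sub>0\<^sup>2 + 4 s / N + 64 s p\<^sub>0 + 32 n\<^sup>4 D\<^sup>3 / N\<^sup>2\<close> under the alternative. Since the estimate of
  \<open>p\<^sub>0\<close> concentrates around the same value under both laws, Chebyshev's inequality bounds both
  errors by terms that vanish as soon as \<open>R = s / (\<surd>N p\<^sub>0)\<close>, \<open>n\<^sup>2 D\<close> and \<open>N\<^sup>2 p\<^sub>0\<close> diverge. The
  hypothesis is normalised by \<open>p\<^sub>0'\<close> instead of \<open>p\<^sub>0\<close>; where \<open>p\<^sub>0 > 2 p\<^sub>0'\<close>, the lower bound
  \<open>p\<^sub>0 \<ge> C / N\<close> alone forces \<open>R \<ge> C \<surd>N / 4\<close>.\<close>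

section \<open>Independent Bernoulli variables\<close>

text \<open>The default \<open>False\<close> is the one used inside \<open>random_graph\<close>, so
  that law is an image of this product under \<open>adjacency\<close>.\<close>

definition bernoulli_product :: "'a set \<Rightarrow> ('a \<Rightarrow> real) \<Rightarrow> ('a \<Rightarrow> bool) pmf" where
  "bernoulli_product A P = Pi_pmf A False (\<lambda>e. bernoulli_pmf (P e))"

definition centered :: "('a \<Rightarrow> real) \<Rightarrow> ('a \<Rightarrow> bool) \<Rightarrow> 'a \<Rightarrow> real" where
  "centered P \<xi> e = of_bool (\<xi> e) - P e"

lemma finite_set_bernoulli_product:
  assumes "finite A"
  shows "finite (set_pmf (bernoulli_product A P))"
proof -
  have "finite (PiE_dflt A False (set_pmf \<circ> (\<lambda>e. bernoulli_pmf (P e))))"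
    by (intro finite_PiE_dflt assms finite)
  then show ?thesis
    unfolding bernoulli_product_def
    by (rule finite_subset[OF set_Pi_pmf_subset'[OF assms]])
qed

lemma integrable_bernoulli_product:
  fixes F :: "('a \<Rightarrow> bool) \<Rightarrow> real"
  assumes "finite A"
  shows "integrable (measure_pmf (bernoulli_product A P)) F"
  using assms by (intro integrable_measure_pmf_finite finite_set_bernoulli_product)

text \<open>Conditioning on the coordinate \<open>x\<close>. This drives the inductions on the index
  set that compute the second moments below.\<close>

lemma expectation_bernoulli_product_insert:
  fixes F :: "('a \<Rightarrow> bool) \<Rightarrow> real"
  assumes "finite A" "x \<notin> A" "0 \<le> P x" "P x \<le> 1"
  shows "measure_pmf.expectation (bernoulli_product (insert x A) P) F =
    measure_pmf.expectation (bernoulli_product A P)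
      (\<lambda>\<xi>. P x * F (\<xi>(x := True)) + (1 - P x) * F (\<xi>(x := False)))"
proof -
  let ?B = "bernoulli_product A P"
  note fin = finite_set_bernoulli_product[OF assms(1), of P]
  have eq: "bernoulli_product (insert x A) P =
      bernoulli_pmf (P x) \<bind> (\<lambda>y. map_pmf (\<lambda>f. f(x := y)) ?B)"
    unfolding bernoulli_product_def
    by (simp add: Pi_pmf_insert'[OF assms(1,2)] map_pmf_def)
  have "measure_pmf.expectation (bernoulli_product (insert x A) P) F =
      (\<Sum>y\<in>UNIV. pmf (bernoulli_pmf (P x)) y *\<^sub>R
        measure_pmf.expectation (map_pmf (\<lambda>f. f(x := y)) ?B) F)"
    unfolding eq by (rule pmf_expectation_bind) (use fin in auto)
  also have "\<dots> = P x * measure_pmf.expectation ?B (\<lambda>\<xi>. F (\<xi>(x := True))) +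
      (1 - P x) * measure_pmf.expectation ?B (\<lambda>\<xi>. F (\<xi>(x := False)))"
    using assms(3,4) by (simp add: UNIV_bool)
  also have "\<dots> = measure_pmf.expectation ?B
      (\<lambda>\<xi>. P x * F (\<xi>(x := True)) + (1 - P x) * F (\<xi>(x := False)))"
    by (subst Bochner_Integration.integral_add)
      (auto intro!: integrable_bernoulli_product assms(1))
  finally show ?thesis .
qed

text \<open>Averaging over one coordinate produces no cross term:
  \<open>p (a + (1 - p) h)\<^sup>2 + (1 - p) (a - p h)\<^sup>2 = a\<^sup>2 + p (1 - p) h\<^sup>2\<close>.\<close>

lemma expectation_square_insert:
  fixes G H :: "('a \<Rightarrow> bool) \<Rightarrow> real"
  assumes "finite A" "x \<notin> A" "0 \<le> P x" "P x \<le> 1"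
    and "\<And>\<xi> b. F (\<xi>(x := b)) = G \<xi> + (of_bool b - P x) * H \<xi>"
  shows "measure_pmf.expectation (bernoulli_product (insert x A) P) (\<lambda>\<xi>. (F \<xi>)\<^sup>2) =
    measure_pmf.expectation (bernoulli_product A P) (\<lambda>\<xi>. (G \<xi>)\<^sup>2) +
    P x * (1 - P x) * measure_pmf.expectation (bernoulli_product A P) (\<lambda>\<xi>. (H \<xi>)\<^sup>2)"
proof -
  have id: "p * (a + (1 - p) * h)\<^sup>2 + (1 - p) * (a + (0 - p) * h)\<^sup>2 = a\<^sup>2 + p * (1 - p) * h\<^sup>2"
    for p a h :: real
    by (simp add: power2_eq_square algebra_simps)
  have "measure_pmf.expectation (bernoulli_product (insert x A) P) (\<lambda>\<xi>. (F \<xi>)\<^sup>2) =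
      measure_pmf.expectation (bernoulli_product A P)
        (\<lambda>\<xi>. (G \<xi>)\<^sup>2 + P x * (1 - P x) * (H \<xi>)\<^sup>2)"
    by (simp add: expectation_bernoulli_product_insert assms
        of_bool_def id[symmetric])
  then show ?thesis
    by (simp add: integrable_bernoulli_product assms(1))
qed

lemma centered_fun_upd [simp]: "centered P (\<xi>(x := b)) x = of_bool b - P x"
  by (simp add: centered_def)

lemma centered_fun_upd_other: "e \<noteq> x \<Longrightarrow> centered P (\<xi>(x := b)) e = centered P \<xi> e"
  by (simp add: centered_def)

text \<open>Induction on \<open>A\<close>: a new coordinate enters affinely with coefficient
  \<open>a x\<close>, so it adds its variance times the square of \<open>a x\<close>. The constant
  \<open>c\<close> is carried along because the coefficient of one coordinate in a quadratic form is
  an affine form in the others.\<close>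

lemma second_moment_linear_form:
  assumes "finite A" "\<And>e. e \<in> A \<Longrightarrow> 0 \<le> P e \<and> P e \<le> 1"
  shows "measure_pmf.expectation (bernoulli_product A P)
      (\<lambda>\<xi>. (c + (\<Sum>e\<in>A. a e * centered P \<xi> e))\<^sup>2) =
    c\<^sup>2 + (\<Sum>e\<in>A. (a e)\<^sup>2 * (P e * (1 - P e)))"
  using assms
proof (induction A rule: finite_induct)
  case (insert x A)
  have "(c + (\<Sum>e\<in>insert x A. a e * centered P (\<xi>(x := b)) e)) =
      (c + (\<Sum>e\<in>A. a e * centered P \<xi> e)) + (of_bool b - P x) * a x" for \<xi> b
  proof -
    have "(\<Sum>e\<in>A. a e * centered P (\<xi>(x := b)) e) = (\<Sum>e\<in>A. a e * centered P \<xi> e)"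
      using insert.hyps by (intro sum.cong refl) (metis centered_fun_upd_other)
    then show ?thesis
      using insert.hyps by (simp add: algebra_simps)
  qed
  then have "measure_pmf.expectation (bernoulli_product (insert x A) P)
      (\<lambda>\<xi>. (c + (\<Sum>e\<in>insert x A. a e * centered P \<xi> e))\<^sup>2) =
    measure_pmf.expectation (bernoulli_product A P)
      (\<lambda>\<xi>. (c + (\<Sum>e\<in>A. a e * centered P \<xi> e))\<^sup>2) +
    P x * (1 - P x) * measure_pmf.expectation (bernoulli_product A P) (\<lambda>\<xi>. (a x)\<^sup>2)"
    using insert.hyps insert.prems by (intro expectation_square_insert) auto
  then show ?case
    using insert by simp
qed simp

text \<open>With zero diagonal the form is affine in each coordinate, so a new coordinate
  contributes its variance times the second moment of its coefficient, an affine form in the earlier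
  coordinates. No product of the linear and the quadratic part survives.\<close>

lemma second_moment_quadratic_form:
  assumes "finite A" "\<And>e. e \<in> A \<Longrightarrow> 0 \<le> P e \<and> P e \<le> 1"
    and "\<And>e f. K e f = K f e" "\<And>e. e \<in> A \<Longrightarrow> K e e = 0"
  shows "measure_pmf.expectation (bernoulli_product A P)
      (\<lambda>\<xi>. ((\<Sum>e\<in>A. g e * centered P \<xi> e) +
        (\<Sum>e\<in>A. \<Sum>f\<in>A. K e f * centered P \<xi> e * centered P \<xi> f))\<^sup>2) =
    (\<Sum>e\<in>A. (g e)\<^sup>2 * (P e * (1 - P e))) +
    2 * (\<Sum>e\<in>A. \<Sum>f\<in>A. (K e f)\<^sup>2 * (P e * (1 - P e)) * (P f * (1 - P f)))"
  using assms(1,2,4)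
proof (induction A rule: finite_induct)
  case (insert x A)
  let ?Z = "centered P"
  let ?v = "\<lambda>e. P e * (1 - P e)"
  \<comment> \<open>The coefficient of the new coordinate; the 2 collects the ordered pairs
    \<open>(x, e)\<close> and \<open>(e, x)\<close>.\<close>
  let ?L = "\<lambda>\<xi>. g x + (\<Sum>e\<in>A. 2 * K x e * ?Z \<xi> e)"
  have split: "(\<Sum>e\<in>insert x A. \<Sum>f\<in>insert x A. k e f) =
      (\<Sum>e\<in>A. \<Sum>f\<in>A. k e f) + 2 * (\<Sum>e\<in>A. k x e)"
    if "\<And>e f. k e f = k f e" "k x x = 0" for k :: "_ \<Rightarrow> _ \<Rightarrow> real"
  proof -
    have "(\<Sum>e\<in>A. k e x) = (\<Sum>e\<in>A. k x e)"
      using that by simp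
    then show ?thesis
      using insert.hyps that by (simp add: sum.distrib)
  qed
  have upd: "(\<Sum>e\<in>insert x A. g e * ?Z (\<xi>(x := b)) e) +
        (\<Sum>e\<in>insert x A. \<Sum>f\<in>insert x A. K e f * ?Z (\<xi>(x := b)) e * ?Z (\<xi>(x := b)) f) =
      ((\<Sum>e\<in>A. g e * ?Z \<xi> e) + (\<Sum>e\<in>A. \<Sum>f\<in>A. K e f * ?Z \<xi> e * ?Z \<xi> f)) +
        (of_bool b - P x) * ?L \<xi>" for \<xi> b
  proof -
    have Z: "?Z (\<xi>(x := b)) e = ?Z \<xi> e" if "e \<in> A" for e
      using that insert.hyps by (auto intro: centered_fun_upd_other)
    have "(\<Sum>e\<in>insert x A. \<Sum>f\<in>insert x A. K e f * ?Z (\<xi>(x := b)) e * ?Z (\<xi>(x := b)) f) =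
      (\<Sum>e\<in>A. \<Sum>f\<in>A. K e f * ?Z (\<xi>(x := b)) e * ?Z (\<xi>(x := b)) f) +
      2 * (\<Sum>e\<in>A. K x e * ?Z (\<xi>(x := b)) x * ?Z (\<xi>(x := b)) e)"
      by (rule split) (simp_all add: insert.prems(2) assms(3) mult.assoc mult.left_commute)
    also have "(\<Sum>e\<in>A. \<Sum>f\<in>A. K e f * ?Z (\<xi>(x := b)) e * ?Z (\<xi>(x := b)) f) =
        (\<Sum>e\<in>A. \<Sum>f\<in>A. K e f * ?Z \<xi> e * ?Z \<xi> f)"
      by (intro sum.cong refl) (simp add: Z)
    also have "2 * (\<Sum>e\<in>A. K x e * ?Z (\<xi>(x := b)) x * ?Z (\<xi>(x := b)) e) =
        (of_bool b - P x) * (\<Sum>e\<in>A. 2 * K x e * ?Z \<xi> e)"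
      unfolding sum_distrib_left by (intro sum.cong refl) (simp add: Z)
    finally have quad: "(\<Sum>e\<in>insert x A. \<Sum>f\<in>insert x A.
          K e f * ?Z (\<xi>(x := b)) e * ?Z (\<xi>(x := b)) f) =
        (\<Sum>e\<in>A. \<Sum>f\<in>A. K e f * ?Z \<xi> e * ?Z \<xi> f) +
        (of_bool b - P x) * (\<Sum>e\<in>A. 2 * K x e * ?Z \<xi> e)" .
    have "(\<Sum>e\<in>A. g e * ?Z (\<xi>(x := b)) e) = (\<Sum>e\<in>A. g e * ?Z \<xi> e)"
      by (intro sum.cong refl) (simp add: Z)
    then show ?thesis
      unfolding quad using insert.hyps by (simp add: distrib_left)
  qed
  have "(\<Sum>e\<in>insert x A. \<Sum>f\<in>insert x A. (K e f)\<^sup>2 * ?v e * ?v f) =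
      (\<Sum>e\<in>A. \<Sum>f\<in>A. (K e f)\<^sup>2 * ?v e * ?v f) + 2 * (\<Sum>e\<in>A. (K x e)\<^sup>2 * ?v x * ?v e)"
    using insert.prems(2) assms(3) by (intro split) (auto simp: ac_simps)
  moreover have "measure_pmf.expectation (bernoulli_product A P) (\<lambda>\<xi>. (?L \<xi>)\<^sup>2) =
      (g x)\<^sup>2 + (\<Sum>e\<in>A. (2 * K x e)\<^sup>2 * ?v e)"
    using insert.hyps insert.prems by (intro second_moment_linear_form) auto
  \<comment> \<open>Squaring the doubled coefficient gives 4, while the two ordered pairs account
    for 2; hence the factor 2 before the double sum.\<close>
  moreover have "?v x * (\<Sum>e\<in>A. (2 * K x e)\<^sup>2 * ?v e) = 4 * (\<Sum>e\<in>A. (K x e)\<^sup>2 * ?v x * ?v e)"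
    by (simp add: sum_distrib_left power_mult_distrib ac_simps)
  moreover have "measure_pmf.expectation (bernoulli_product (insert x A) P)
      (\<lambda>\<xi>. ((\<Sum>e\<in>insert x A. g e * ?Z \<xi> e) +
        (\<Sum>e\<in>insert x A. \<Sum>f\<in>insert x A. K e f * ?Z \<xi> e * ?Z \<xi> f))\<^sup>2) =
    measure_pmf.expectation (bernoulli_product A P)
      (\<lambda>\<xi>. ((\<Sum>e\<in>A. g e * ?Z \<xi> e) + (\<Sum>e\<in>A. \<Sum>f\<in>A. K e f * ?Z \<xi> e * ?Z \<xi> f))\<^sup>2) +
    ?v x * measure_pmf.expectation (bernoulli_product A P) (\<lambda>\<xi>. (?L \<xi>)\<^sup>2)"
    using insert.hyps insert.prems by (intro expectation_square_insert upd) auto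
  moreover have "measure_pmf.expectation (bernoulli_product A P)
      (\<lambda>\<xi>. ((\<Sum>e\<in>A. g e * ?Z \<xi> e) + (\<Sum>e\<in>A. \<Sum>f\<in>A. K e f * ?Z \<xi> e * ?Z \<xi> f))\<^sup>2) =
    (\<Sum>e\<in>A. (g e)\<^sup>2 * ?v e) + 2 * (\<Sum>e\<in>A. \<Sum>f\<in>A. (K e f)\<^sup>2 * ?v e * ?v f)"
    using insert.prems by (intro insert.IH) auto
  moreover have "(\<Sum>e\<in>insert x A. (g e)\<^sup>2 * ?v e) = (\<Sum>e\<in>A. (g e)\<^sup>2 * ?v e) + ?v x * (g x)\<^sup>2"
    using insert.hyps by simp
  ultimately show ?case
    by (simp only: distrib_left)
qed simp

text \<open>Markov's inequality for the square of \<open>F\<close>, which divided by the square of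
  \<open>c\<close> dominates the indicator of \<open>B\<close>.\<close>

lemma prob_le_second_moment:
  fixes F :: "('a \<Rightarrow> bool) \<Rightarrow> real"
  assumes "finite A" "c > 0" "\<And>\<xi>. \<xi> \<in> B \<Longrightarrow> c \<le> \<bar>F \<xi>\<bar>"
  shows "measure_pmf.prob (bernoulli_product A P) B \<le>
    measure_pmf.expectation (bernoulli_product A P) (\<lambda>\<xi>. (F \<xi>)\<^sup>2) / c\<^sup>2"
proof -
  have "measure_pmf.prob (bernoulli_product A P) B =
      measure_pmf.expectation (bernoulli_product A P) (indicator B)"
    by simp
  also have "\<dots> \<le> measure_pmf.expectation (bernoulli_product A P) (\<lambda>\<xi>. (F \<xi>)\<^sup>2 / c\<^sup>2)"
  proof (rule integral_mono)
    fix \<xi>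
    have "1 \<le> (F \<xi>)\<^sup>2 / c\<^sup>2" if "\<xi> \<in> B"
      using power_mono[OF assms(3)[OF that], of 2] assms(2) by simp
    then show "indicator B \<xi> \<le> (F \<xi>)\<^sup>2 / c\<^sup>2"
      by (auto simp: indicator_def)
  qed (auto intro!: integrable_bernoulli_product assms(1))
  finally show ?thesis by simp
qed

section \<open>The kernel of the degree variance statistic\<close>

definition incidence :: "nat \<Rightarrow> nat \<times> nat \<Rightarrow> real" where
  "incidence i e = of_bool (i = fst e \<or> i = snd e)"

text \<open>The weights are arbitrary reals: edge indicators give the degrees, edge probabilities
  the expected degrees.\<close>

definition weighted_degree :: "nat \<Rightarrow> (nat \<times> nat \<Rightarrow> real) \<Rightarrow> nat \<Rightarrow> real" where
  "weighted_degree N x i = (\<Sum>e\<in>edges N. incidence i e * x e)"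

text \<open>The inner sum counts common endpoints, so on edges the entry is 0 for
  \<open>e = f\<close>, \<open>(N - 3) / ((N - 2) (N + 1))\<close> for edges sharing one vertex and
  \<open>- 4 / ((N - 2) (N + 1))\<close> for disjoint ones. The three terms of the numerator stem
  from the squared degrees, the squared number of edges and the terms linear in that number.\<close>

definition edge_kernel :: "nat \<Rightarrow> nat \<times> nat \<Rightarrow> nat \<times> nat \<Rightarrow> real" where
  "edge_kernel N e f =
    ((real N + 1) * (\<Sum>i\<in>{1..N}. incidence i e * incidence i f) - 4
      - 2 * (real N - 1) * of_bool (e = f)) / ((real N - 2) * (real N + 1))"

section \<open>Incidences, degrees and double counting\<close>

lemma finite_edges [simp, intro]: "finite (edges N)"
  by (rule finite_subset[of _ "{1..N} \<times> {1..N}"]) (auto simp: edges_def)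

lemma incidence_nonneg: "0 \<le> incidence i e"
  by (simp add: incidence_def)

lemma incidence_square: "incidence i e * incidence i e = incidence i e"
  by (simp add: incidence_def)

lemma sum_incidence:
  assumes "e \<in> edges N"
  shows "(\<Sum>i\<in>{1..N}. incidence i e * \<phi> i) = \<phi> (fst e) + \<phi> (snd e)"
proof -
  have "(\<Sum>i\<in>{1..N}. incidence i e * \<phi> i) = (\<Sum>i\<in>{fst e, snd e}. \<phi> i)"
    using assms by (intro sum.mono_neutral_cong_right) (auto simp: incidence_def edges_def)
  then show ?thesis
    using assms by (auto simp: edges_def)
qed

lemma weighted_degree_eq:
  assumes "i \<in> {1..N}"
  shows "weighted_degree N x i = (\<Sum>j\<in>{1..N} - {i}. x (min i j, max i j))"
proof -
  have "weighted_degree N x i = (\<Sum>e\<in>{e \<in> edges N. i = fst e \<or> i = snd e}. x e)"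
    unfolding weighted_degree_def
    by (intro sum.mono_neutral_cong_right) (auto simp: incidence_def)
  also have "\<dots> = (\<Sum>j\<in>{1..N} - {i}. x (min i j, max i j))"
    using assms
    by (intro sum.reindex_bij_witness[where
          i = "\<lambda>j. (min i j, max i j)" and j = "\<lambda>e. if i = fst e then snd e else fst e"])
      (auto simp: edges_def min_def max_def split: if_splits)
  finally show ?thesis .
qed

text \<open>Double counting of the pairs formed by an edge and one of its endpoints. A constant
  \<open>\<phi>\<close> gives the handshake identity.\<close>

lemma sum_weighted_degree:
  "(\<Sum>i\<in>{1..N}. \<phi> i * weighted_degree N x i) = (\<Sum>e\<in>edges N. (\<phi> (fst e) + \<phi> (snd e)) * x e)"
proof -
  have "(\<Sum>i\<in>{1..N}. \<phi> i * weighted_degree N x i) =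
      (\<Sum>e\<in>edges N. (\<Sum>i\<in>{1..N}. incidence i e * \<phi> i) * x e)"
    unfolding weighted_degree_def sum_distrib_left sum_distrib_right
    by (subst sum.swap) (simp add: ac_simps)
  also have "\<dots> = (\<Sum>e\<in>edges N. (\<phi> (fst e) + \<phi> (snd e)) * x e)"
    by (intro sum.cong refl) (simp only: sum_incidence)
  finally show ?thesis .
qed

lemma handshake: "(\<Sum>i\<in>{1..N}. weighted_degree N x i) = 2 * (\<Sum>e\<in>edges N. x e)"
  using sum_weighted_degree[of "\<lambda>_. 1" N x] by (simp add: sum_distrib_left)

lemma weighted_degree_const:
  "i \<in> {1..N} \<Longrightarrow> weighted_degree N (\<lambda>_. c) i = (real N - 1) * c"
  by (simp add: weighted_degree_eq of_nat_diff)

lemma card_edges: "real (card (edges N)) = num_pairs N"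
proof -
  have "(\<Sum>i\<in>{1..N}. weighted_degree N (\<lambda>_. 1) i) = real N * (real N - 1)"
    by (simp add: weighted_degree_const)
  then have "2 * (\<Sum>e\<in>edges N. 1) = real N * (real N - 1)"
    by (simp only: handshake)
  then show ?thesis
    by (simp add: num_pairs_def)
qed

section \<open>Algebra of the kernel: row sums, bilinear form and diagonal\<close>

lemma edge_kernel_commute: "edge_kernel N e f = edge_kernel N f e"
  by (cases "e = f") (simp_all add: edge_kernel_def mult.commute)

text \<open>The overlap of \<open>e\<close> with \<open>f\<close> is the incidence of
  \<open>f\<close> at the two endpoints of \<open>e\<close>, so summing over \<open>f\<close> yields
  the weighted degrees there.\<close>

lemma sum_edge_kernel:
  assumes "e \<in> edges N"
  shows "(\<Sum>f\<in>edges N. edge_kernel N e f * y f) =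
    ((real N + 1) * (weighted_degree N y (fst e) + weighted_degree N y (snd e))
      - 4 * (\<Sum>f\<in>edges N. y f) - 2 * (real N - 1) * y e) / ((real N - 2) * (real N + 1))"
proof -
  let ?c = "(real N - 2) * (real N + 1)"
  have ovl: "(\<Sum>i\<in>{1..N}. incidence i e * incidence i f) = incidence (fst e) f + incidence (snd e) f"
    for f
    using sum_incidence[OF assms, of "\<lambda>i. incidence i f"] .
  have "(\<Sum>f\<in>edges N. edge_kernel N e f * y f) =
      (\<Sum>f\<in>edges N. (real N + 1) * (incidence (fst e) f * y f + incidence (snd e) f * y f)
        - 4 * y f - 2 * (real N - 1) * (if e = f then y f else 0)) / ?c"
    unfolding edge_kernel_def ovl sum_divide_distrib
    by (intro sum.cong refl) (simp add: algebra_simps)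
  also have "(\<Sum>f\<in>edges N. (real N + 1) * (incidence (fst e) f * y f + incidence (snd e) f * y f)
        - 4 * y f - 2 * (real N - 1) * (if e = f then y f else 0)) =
      (real N + 1) * (weighted_degree N y (fst e) + weighted_degree N y (snd e))
      - 4 * (\<Sum>f\<in>edges N. y f) - 2 * (real N - 1) * y e"
    unfolding weighted_degree_def sum_subtractf sum_distrib_left[symmetric] sum.distrib
    using assms by simp
  finally show ?thesis .
qed

text \<open>Reduces to \<open>2 (N + 1) (N - 1) - 2 N (N - 1) - 2 (N - 1) = 0\<close>. Hence a
  common background probability is invisible to the form: only the excess inside the community
  affects its mean and its linear part.\<close>

lemma sum_edge_kernel_const:
  assumes "e \<in> edges N"
  shows "(\<Sum>f\<in>edges N. edge_kernel N e f * c) = 0"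
proof -
  have e: "fst e \<in> {1..N}" "snd e \<in> {1..N}"
    using assms by (auto simp: edges_def)
  have "(\<Sum>f\<in>edges N. edge_kernel N e f * c) =
      ((real N + 1) * (weighted_degree N (\<lambda>_. c) (fst e) + weighted_degree N (\<lambda>_. c) (snd e))
        - 4 * (\<Sum>f\<in>edges N. c) - 2 * (real N - 1) * c) / ((real N - 2) * (real N + 1))"
    by (rule sum_edge_kernel[OF assms])
  also have "\<dots> = 0"
    unfolding weighted_degree_const[OF e(1)] weighted_degree_const[OF e(2)]
    by (simp add: card_edges num_pairs_def field_simps)
  finally show ?thesis .
qed

text \<open>At the edge indicators this evaluates the statistic, at the edge probabilities its
  mean.\<close>

lemma edge_kernel_form:
  "(\<Sum>e\<in>edges N. \<Sum>f\<in>edges N. edge_kernel N e f * x e * y f) =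
    ((real N + 1) * (\<Sum>i\<in>{1..N}. weighted_degree N x i * weighted_degree N y i)
      - 4 * (\<Sum>e\<in>edges N. x e) * (\<Sum>e\<in>edges N. y e)
      - 2 * (real N - 1) * (\<Sum>e\<in>edges N. x e * y e)) / ((real N - 2) * (real N + 1))"
proof -
  let ?c = "(real N - 2) * (real N + 1)" and ?d = "weighted_degree N y"
  have "(\<Sum>e\<in>edges N. \<Sum>f\<in>edges N. edge_kernel N e f * x e * y f) =
      (\<Sum>e\<in>edges N. x e * (\<Sum>f\<in>edges N. edge_kernel N e f * y f))"
    by (simp add: sum_distrib_left ac_simps)
  also have "\<dots> = (\<Sum>e\<in>edges N. x e * (((real N + 1) * (?d (fst e) + ?d (snd e))
      - 4 * (\<Sum>f\<in>edges N. y f) - 2 * (real N - 1) * y e) / ?c))"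
    by (intro sum.cong refl) (simp only: sum_edge_kernel)
  also have "\<dots> = (\<Sum>e\<in>edges N. (real N + 1) * ((?d (fst e) + ?d (snd e)) * x e)
      - 4 * (\<Sum>f\<in>edges N. y f) * x e - 2 * (real N - 1) * (x e * y e)) / ?c"
    unfolding sum_divide_distrib by (intro sum.cong refl) (simp add: algebra_simps)
  also have "(\<Sum>e\<in>edges N. (real N + 1) * ((?d (fst e) + ?d (snd e)) * x e)
      - 4 * (\<Sum>f\<in>edges N. y f) * x e - 2 * (real N - 1) * (x e * y e)) =
      (real N + 1) * (\<Sum>e\<in>edges N. (?d (fst e) + ?d (snd e)) * x e)
      - 4 * (\<Sum>f\<in>edges N. y f) * (\<Sum>e\<in>edges N. x e)
      - 2 * (real N - 1) * (\<Sum>e\<in>edges N. x e * y e)"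
    by (simp add: sum_subtractf sum_distrib_left)
  also have "(\<Sum>e\<in>edges N. (?d (fst e) + ?d (snd e)) * x e) =
      (\<Sum>i\<in>{1..N}. weighted_degree N x i * weighted_degree N y i)"
    unfolding sum_weighted_degree[of ?d N x, symmetric] by (simp only: mult.commute)
  finally show ?thesis
    by (simp only: ac_simps)
qed

text \<open>An edge has two endpoints in common with itself, and
  \<open>2 (N + 1) - 4 - 2 (N - 1) = 0\<close>. As no squared indicator occurs, independence makes
  the mean of the form equal to the form of the means.\<close>

lemma edge_kernel_self:
  assumes "e \<in> edges N"
  shows "edge_kernel N e e = 0"
proof -
  have "(\<Sum>i\<in>{1..N}. incidence i e * incidence i e) = 2"
    using sum_incidence[OF assms, of "\<lambda>_. 1"] by (simp add: incidence_square)
  then show ?thesis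
    by (simp add: edge_kernel_def)
qed

section \<open>Size of the kernel entries\<close>

lemma denominator_ge:
  assumes "N \<ge> 4"
  shows "(real N)\<^sup>2 / 2 \<le> (real N - 2) * (real N + 1)"
proof -
  have N: "real N \<ge> 4" using assms by simp
  have "4 * real N \<le> real N * real N"
    using N by (intro mult_right_mono) auto
  moreover have "(real N - 2) * (real N + 1) = real N * real N - real N - 2"
    by (simp add: algebra_simps)
  ultimately show ?thesis
    using N unfolding power2_eq_square by linarith
qed

text \<open>Distinct edges share at most one vertex: overlap 1 gives an entry of at most 1/N,
  overlap 0 one of modulus at most 8/N^2. The overlap is kept in the bound so that summation over
  edges produces squared degrees.\<close>

lemma edge_kernel_square_le:
  assumes "N \<ge> 4" "e \<in> edges N" "f \<in> edges N"
  shows "(edge_kernel N e f)\<^sup>2 \<le>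
    (\<Sum>i\<in>{1..N}. incidence i e * incidence i f) / (real N)\<^sup>2 + 64 / real N ^ 4"
proof (cases "e = f")
  case True
  then show ?thesis
    using assms by (simp add: edge_kernel_self incidence_nonneg sum_nonneg)
next
  case False
  let ?o = "\<Sum>i\<in>{1..N}. incidence i e * incidence i f"
  have N: "real N \<ge> 4" using assms(1) by simp
  have pos: "0 < (real N - 2) * (real N + 1)" using N by simp
  note big = denominator_ge[OF assms(1)]
  have "?o = incidence (fst e) f + incidence (snd e) f"
    by (rule sum_incidence[OF assms(2)])
  \<comment> \<open>Edges are increasing pairs, so they coincide once both endpoints of
    \<open>e\<close> lie on \<open>f\<close>.\<close>
  moreover have "incidence (fst e) f = 0 \<or> incidence (snd e) f = 0"
    using assms(2,3) False by (cases e; cases f) (auto simp: incidence_def edges_def)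
  moreover have "incidence i f = 0 \<or> incidence i f = 1" for i
    by (simp add: incidence_def)
  ultimately consider "?o = 0" | "?o = 1"
    by (metis add.left_neutral add.right_neutral)
  then show ?thesis
  proof cases
    case 1
    have "(edge_kernel N e f)\<^sup>2 = (4 / ((real N - 2) * (real N + 1)))\<^sup>2"
      unfolding edge_kernel_def 1 using False by (simp add: power2_eq_square)
    also have "\<dots> \<le> (4 / ((real N)\<^sup>2 / 2))\<^sup>2"
      using big pos N by (intro power_mono divide_left_mono mult_pos_pos) auto
    also have "\<dots> = 64 / real N ^ 4"
      by (simp add: power_divide)
    finally show ?thesis using 1 by simp
  next
    case 2
    have K: "edge_kernel N e f = (real N - 3) / ((real N - 2) * (real N + 1))"
      unfolding edge_kernel_def 2 using False by simp
    have "edge_kernel N e f \<le> 1 / real N"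
      unfolding K using pos N by (simp add: divide_simps) (simp add: algebra_simps)
    moreover have "0 \<le> edge_kernel N e f"
      unfolding K using N by simp
    ultimately have "(edge_kernel N e f)\<^sup>2 \<le> (1 / real N)\<^sup>2"
      by (intro power_mono)
    then show ?thesis using 2 by (simp add: power_divide add_increasing2)
  qed
qed

section \<open>The statistic as a quadratic form in the edge indicators\<close>

lemma degree_adjacency:
  assumes "i \<in> {1..N}"
  shows "degree N (adjacency \<xi>) i = weighted_degree N (\<lambda>e. of_bool (\<xi> e)) i"
  unfolding degree_def weighted_degree_eq[OF assms]
  by (intro sum.cong refl) (auto simp: adjacency_def min_def max_def)

lemma total_degree_adjacency:
  "total_degree N (adjacency \<xi>) = (\<Sum>e\<in>edges N. of_bool (\<xi> e))"
  unfolding total_degree_def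
  by (intro sum.cong refl) (auto simp: edges_def adjacency_def)

text \<open>Both variances are polynomials in the number of edges \<open>W\<close> and the sum
  \<open>q\<close> of squared degrees; the term linear in \<open>W\<close> becomes the diagonal
  correction of the kernel.\<close>

lemma V2_minus_V1:
  fixes \<xi> :: "nat \<times> nat \<Rightarrow> bool"
  defines "X \<equiv> \<lambda>e. of_bool (\<xi> e) :: real"
  assumes "N \<ge> 3"
  shows "V2 N (adjacency \<xi>) - V1 N (adjacency \<xi>) =
    (\<Sum>e\<in>edges N. \<Sum>f\<in>edges N. edge_kernel N e f * X e * X f)"
proof -
  define W q where "W = (\<Sum>e\<in>edges N. X e)"
    and "q = (\<Sum>i\<in>{1..N}. (weighted_degree N X i)\<^sup>2)"
  define r where "r = real N"
  have r: "r \<ge> 3" using assms(2) by (simp add: r_def)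
  define M where "M = num_pairs N"
  have M: "M = r * (r - 1) / 2" by (simp add: M_def num_pairs_def r_def)
  have M1: "M - 1 = (r - 2) * (r + 1) / 2" by (simp add: M field_simps)
  have p: "p0_hat N (adjacency \<xi>) = W / M"
    by (simp add: p0_hat_def total_degree_adjacency W_def X_def M_def)
  \<comment> \<open>The degrees are centred at their average \<open>2 * W / r\<close>.\<close>
  have c: "(r - 1) * (W / M) = 2 * W / r"
    using r by (simp add: M field_simps)
  have square: "(\<Sum>i\<in>{1..N}. (weighted_degree N X i - k)\<^sup>2) =
      q - 2 * k * (\<Sum>i\<in>{1..N}. weighted_degree N X i) + r * k\<^sup>2" for k
    by (simp add: power2_diff sum.distrib sum_subtractf q_def sum_distrib_left r_def ac_simps)
  have "(\<Sum>i\<in>{1..N}. (degree N (adjacency \<xi>) i - (real N - 1) * p0_hat N (adjacency \<xi>))\<^sup>2) =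
      (\<Sum>i\<in>{1..N}. (weighted_degree N X i - 2 * W / r)\<^sup>2)"
    by (intro sum.cong refl) (simp only: degree_adjacency p c r_def[symmetric] flip: X_def)
  also have "\<dots> = q - 2 * (2 * W / r) * (\<Sum>i\<in>{1..N}. weighted_degree N X i) + r * (2 * W / r)\<^sup>2"
    using square[of "2 * W / r"] .
  also have "\<dots> = q - 4 * W\<^sup>2 / r"
    unfolding handshake W_def[symmetric] using r by (simp add: field_simps power2_eq_square)
  finally have V2: "V2 N (adjacency \<xi>) = (q - 4 * W\<^sup>2 / r) / (r - 2)"
    by (simp add: V2_def r_def)
  have "V1 N (adjacency \<xi>) = (r - 1) * (W / M) * (M / (M - 1)) * (1 - W / M)"
    by (simp add: V1_def p M_def r_def)
  also have "\<dots> = (2 * W / r) * ((M - W) / (M - 1))"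
  proof -
    have "M \<noteq> 0" using r by (simp add: M)
    moreover from this have "1 - W / M = (M - W) / M"
      by (simp add: diff_divide_distrib)
    ultimately show ?thesis
      unfolding c by simp
  qed
  also have "\<dots> = 4 * W * (M - W) / (r * ((r - 2) * (r + 1)))"
    unfolding M1 by simp
  finally have V1: "V1 N (adjacency \<xi>) = 4 * W * (M - W) / (r * ((r - 2) * (r + 1)))" .
  \<comment> \<open>Indicators equal their squares.\<close>
  have sq: "(\<Sum>e\<in>edges N. X e * X e) = W"
    by (simp add: W_def X_def)
  have "(q - 4 * W\<^sup>2 / r) / (r - 2) - 4 * W * (M - W) / (r * ((r - 2) * (r + 1))) =
      ((r + 1) * q - 4 * W * W - 2 * (r - 1) * W) / ((r - 2) * (r + 1))"
    using r unfolding M by (simp add: divide_simps) (simp add: algebra_simps power2_eq_square)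
  then show ?thesis
    unfolding edge_kernel_form V1 V2 sq q_def W_def[symmetric] r_def power2_eq_square by simp
qed

section \<open>Second moments under a planted community\<close>

lemma num_pairs_pos: "N \<ge> 2 \<Longrightarrow> num_pairs N > 0"
  by (simp add: num_pairs_def)

lemma num_pairs_le: "num_pairs N \<le> (real N)\<^sup>2 / 2"
  by (simp add: num_pairs_def power2_eq_square right_diff_distrib)

text \<open>The overlap is a sum over vertices of products, so the double sum over edges factors at
  each vertex into the square of its weighted degree; the uniform part of the entry bound factors
  into the squared total.\<close>

lemma sum_square_kernel_le:
  assumes "N \<ge> 4" "\<And>e. e \<in> edges N \<Longrightarrow> 0 \<le> P e"
  shows "(\<Sum>e\<in>edges N. \<Sum>f\<in>edges N. (edge_kernel N e f)\<^sup>2 * P e * P f) \<le>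
    (\<Sum>i\<in>{1..N}. (weighted_degree N P i)\<^sup>2) / (real N)\<^sup>2 + 64 / real N ^ 4 * (\<Sum>e\<in>edges N. P e)\<^sup>2"
proof -
  have "(\<Sum>e\<in>edges N. \<Sum>f\<in>edges N. (edge_kernel N e f)\<^sup>2 * P e * P f) \<le>
      (\<Sum>e\<in>edges N. \<Sum>f\<in>edges N.
        ((\<Sum>i\<in>{1..N}. incidence i e * incidence i f) / (real N)\<^sup>2 + 64 / real N ^ 4) * P e * P f)"
    using assms by (intro sum_mono mult_right_mono edge_kernel_square_le) auto
  also have "\<dots> = (\<Sum>e\<in>edges N. \<Sum>f\<in>edges N. \<Sum>i\<in>{1..N}.
        (incidence i e * P e) * (incidence i f * P f)) / (real N)\<^sup>2 +
      64 / real N ^ 4 * (\<Sum>e\<in>edges N. \<Sum>f\<in>edges N. P e * P f)"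
  proof -
    have "((\<Sum>i\<in>{1..N}. incidence i e * incidence i f) / (real N)\<^sup>2 + 64 / real N ^ 4) * P e * P f =
        (\<Sum>i\<in>{1..N}. (incidence i e * P e) * (incidence i f * P f)) / (real N)\<^sup>2 +
        64 / real N ^ 4 * (P e * P f)" for e f
    proof -
      have "(\<Sum>i\<in>{1..N}. (incidence i e * P e) * (incidence i f * P f)) =
          (\<Sum>i\<in>{1..N}. incidence i e * incidence i f) * (P e * P f)"
        unfolding sum_distrib_right by (intro sum.cong refl) (simp add: ac_simps)
      then show ?thesis by (simp add: distrib_right)
    qed
    then show ?thesis
      by (simp only: sum.distrib sum_distrib_left sum_divide_distrib)
  qed
  also have "(\<Sum>e\<in>edges N. \<Sum>f\<in>edges N. \<Sum>i\<in>{1..N}.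
        (incidence i e * P e) * (incidence i f * P f)) =
      (\<Sum>i\<in>{1..N}. \<Sum>e\<in>edges N. \<Sum>f\<in>edges N.
        (incidence i e * P e) * (incidence i f * P f))"
    by (subst sum.swap[of _ "edges N" "{1..N}"], subst sum.swap[of _ "edges N" "{1..N}"]) (rule refl)
  also have "\<dots> = (\<Sum>i\<in>{1..N}. (weighted_degree N P i)\<^sup>2)"
    by (simp add: weighted_degree_def power2_eq_square sum_product)
  also have "(\<Sum>e\<in>edges N. \<Sum>f\<in>edges N. P e * P f) = (\<Sum>e\<in>edges N. P e)\<^sup>2"
    by (simp add: power2_eq_square sum_product)
  finally show ?thesis .
qed

text \<open>For \<open>N \<ge> 3\<close> this is the expectation of \<open>V2 - V1\<close> for
  independent edges with probabilities \<open>P\<close>, as the kernel vanishes on the diagonal.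
  Below it serves as the centring constant.\<close>

definition mean_statistic :: "nat \<Rightarrow> (nat \<times> nat \<Rightarrow> real) \<Rightarrow> real" where
  "mean_statistic N P = (\<Sum>e\<in>edges N. \<Sum>f\<in>edges N. edge_kernel N e f * P e * P f)"

text \<open>Each indicator is its probability plus a centred variable; the two mixed sums agree by
  symmetry of the kernel, hence the factor 2.\<close>

lemma V2_minus_V1_centered:
  assumes "N \<ge> 3"
  shows "V2 N (adjacency \<xi>) - V1 N (adjacency \<xi>) - mean_statistic N P =
    (\<Sum>e\<in>edges N. 2 * (\<Sum>f\<in>edges N. edge_kernel N e f * P f) * centered P \<xi> e) +
    (\<Sum>e\<in>edges N. \<Sum>f\<in>edges N. edge_kernel N e f * centered P \<xi> e * centered P \<xi> f)"
proof -
  let ?Z = "centered P \<xi>" and ?K = "edge_kernel N" and ?E = "edges N"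
  have X: "of_bool (\<xi> e) = P e + ?Z e" for e
    by (simp add: centered_def)
  have "(\<Sum>e\<in>?E. \<Sum>f\<in>?E. ?K e f * ?Z e * P f) = (\<Sum>e\<in>?E. \<Sum>f\<in>?E. ?K e f * P e * ?Z f)"
    by (subst sum.swap) (simp add: edge_kernel_commute ac_simps)
  moreover have "(\<Sum>e\<in>?E. \<Sum>f\<in>?E. ?K e f * ?Z e * P f) =
      (\<Sum>e\<in>?E. (\<Sum>f\<in>?E. ?K e f * P f) * ?Z e)"
    by (simp add: sum_distrib_left sum_distrib_right ac_simps)
  ultimately show ?thesis
    unfolding V2_minus_V1[OF assms] X mean_statistic_def
    by (simp add: distrib_left distrib_right sum.distrib mult.assoc sum_distrib_left[symmetric])
qed

text \<open>The linear and the quadratic part are uncorrelated, so their second moments add; each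
  variance \<open>P e * (1 - P e)\<close> is then bounded by \<open>P e\<close>.\<close>

lemma second_moment_V2_minus_V1:
  assumes "N \<ge> 4" "\<And>e. e \<in> edges N \<Longrightarrow> 0 \<le> P e \<and> P e \<le> 1"
  shows "measure_pmf.expectation (bernoulli_product (edges N) P)
      (\<lambda>\<xi>. (V2 N (adjacency \<xi>) - V1 N (adjacency \<xi>) - mean_statistic N P)\<^sup>2) \<le>
    (\<Sum>e\<in>edges N. P e * (2 * (\<Sum>f\<in>edges N. edge_kernel N e f * P f))\<^sup>2) +
    2 * ((\<Sum>i\<in>{1..N}. (weighted_degree N P i)\<^sup>2) / (real N)\<^sup>2 +
      64 / real N ^ 4 * (\<Sum>e\<in>edges N. P e)\<^sup>2)"
proof -
  let ?g = "\<lambda>e. 2 * (\<Sum>f\<in>edges N. edge_kernel N e f * P f)"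
  have N: "N \<ge> 3" using assms(1) by simp
  have v: "0 \<le> P e * (1 - P e)" "P e * (1 - P e) \<le> P e" if "e \<in> edges N" for e
    using assms(2)[OF that] by (auto simp: mult_left_le)
  have "measure_pmf.expectation (bernoulli_product (edges N) P)
      (\<lambda>\<xi>. (V2 N (adjacency \<xi>) - V1 N (adjacency \<xi>) - mean_statistic N P)\<^sup>2) =
    (\<Sum>e\<in>edges N. (?g e)\<^sup>2 * (P e * (1 - P e))) +
    2 * (\<Sum>e\<in>edges N. \<Sum>f\<in>edges N.
      (edge_kernel N e f)\<^sup>2 * (P e * (1 - P e)) * (P f * (1 - P f)))"
    unfolding V2_minus_V1_centered[OF N]
    by (rule second_moment_quadratic_form[OF finite_edges])
      (auto simp: assms(2) edge_kernel_commute edge_kernel_self)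
  also have "\<dots> \<le> (\<Sum>e\<in>edges N. (?g e)\<^sup>2 * P e) +
      2 * (\<Sum>e\<in>edges N. \<Sum>f\<in>edges N. (edge_kernel N e f)\<^sup>2 * P e * P f)"
    using v assms(2)
    by (intro add_mono mult_left_mono[of _ _ 2] sum_mono mult_left_mono[of _ _ "(_)\<^sup>2"] mult_mono)
      (auto intro!: mult_nonneg_nonneg)
  also have "\<dots> \<le> (\<Sum>e\<in>edges N. (?g e)\<^sup>2 * P e) +
      2 * ((\<Sum>i\<in>{1..N}. (weighted_degree N P i)\<^sup>2) / (real N)\<^sup>2 +
      64 / real N ^ 4 * (\<Sum>e\<in>edges N. P e)\<^sup>2)"
    using assms by (intro add_mono order_refl mult_left_mono sum_square_kernel_le) auto
  finally show ?thesis
    by (simp add: mult.commute)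
qed

text \<open>Probability \<open>p + D\<close> inside \<open>S\<close> and \<open>p\<close> elsewhere.
  The case \<open>D = 0\<close> is the null law, so one set of estimates serves both
  hypotheses.\<close>

definition planted :: "real \<Rightarrow> real \<Rightarrow> nat set \<Rightarrow> nat \<times> nat \<Rightarrow> real" where
  "planted p D S e = p + D * of_bool (fst e \<in> S \<and> snd e \<in> S)"

lemma weighted_degree_planted:
  assumes "S \<subseteq> {1..N}" "i \<in> {1..N}"
  shows "weighted_degree N (planted p D S) i =
    (real N - 1) * p + of_bool (i \<in> S) * ((real (card S) - 1) * D)"
proof -
  have "weighted_degree N (planted p D S) i =
      (\<Sum>j\<in>{1..N} - {i}. p + D * of_bool (i \<in> S \<and> j \<in> S))"
    unfolding weighted_degree_eq[OF assms(2)] planted_def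
    by (intro sum.cong refl) (auto simp: min_def max_def)
  also have "\<dots> = (real N - 1) * p + D * (\<Sum>j\<in>{1..N} - {i}. of_bool (i \<in> S \<and> j \<in> S))"
    using assms(2) by (simp add: sum.distrib sum_distrib_left of_nat_diff)
  also have "(\<Sum>j\<in>{1..N} - {i}. of_bool (i \<in> S \<and> j \<in> S)) =
      (if i \<in> S then real (card S) - 1 else 0)"
  proof (cases "i \<in> S")
    case True
    have "finite S" by (rule finite_subset[OF assms(1)]) simp
    then have "card S \<ge> 1" using True by (auto simp: Suc_le_eq card_gt_0_iff)
    have "(\<Sum>j\<in>{1..N} - {i}. of_bool (i \<in> S \<and> j \<in> S) :: real) = (\<Sum>j\<in>S - {i}. 1)"
      using assms(1) True by (intro sum.mono_neutral_cong_right) auto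
    also have "\<dots> = real (card S) - 1"
      using True \<open>card S \<ge> 1\<close> by (simp add: of_nat_diff)
    finally show ?thesis using True by simp
  qed simp
  finally show ?thesis
    by simp
qed

lemma sum_of_bool_subset:
  fixes N :: nat
  assumes "S \<subseteq> {1..N}"
  shows "(\<Sum>i\<in>{1..N}. of_bool (i \<in> S) * c) = real (card S) * (c :: real)"
proof -
  have "(\<Sum>i\<in>{1..N}. of_bool (i \<in> S) * c) = (\<Sum>i\<in>S. c)"
    using assms by (intro sum.mono_neutral_cong_right) auto
  then show ?thesis by simp
qed

lemma sum_planted:
  assumes "S \<subseteq> {1..N}"
  shows "(\<Sum>e\<in>edges N. planted p D S e) = num_pairs N * p + num_pairs (card S) * D"
proof -
  have "2 * (\<Sum>e\<in>edges N. planted p D S e) = (\<Sum>i\<in>{1..N}. weighted_degree N (planted p D S) i)"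
    by (simp only: handshake)
  also have "\<dots> = (\<Sum>i\<in>{1..N}. (real N - 1) * p + of_bool (i \<in> S) * ((real (card S) - 1) * D))"
    using assms by (intro sum.cong refl weighted_degree_planted)
  also have "\<dots> = real N * ((real N - 1) * p) + real (card S) * ((real (card S) - 1) * D)"
    unfolding sum.distrib sum_of_bool_subset[OF assms] by simp
  finally show ?thesis
    by (simp add: num_pairs_def)
qed

lemma sum_planted_square:
  assumes "S \<subseteq> {1..N}"
  shows "(\<Sum>e\<in>edges N. planted p D S e * planted p D S e) =
    num_pairs N * p\<^sup>2 + num_pairs (card S) * (2 * p * D + D\<^sup>2)"
proof -
  \<comment> \<open>The square of a two-valued profile is again planted, with excess
    \<open>(p + D)^2 - p^2\<close>.\<close>
  have "planted p D S e * planted p D S e = planted (p\<^sup>2) (2 * p * D + D\<^sup>2) S e" for e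
    by (simp add: planted_def power2_eq_square algebra_simps)
  then show ?thesis
    using assms by (simp only: sum_planted)
qed

lemma sum_weighted_degree_planted_square:
  assumes "S \<subseteq> {1..N}"
  shows "(\<Sum>i\<in>{1..N}. weighted_degree N (planted p D S) i * weighted_degree N (planted p D S) i) =
    real N * ((real N - 1) * p)\<^sup>2 +
    real (card S) * (2 * ((real N - 1) * p) * ((real (card S) - 1) * D) + ((real (card S) - 1) * D)\<^sup>2)"
proof -
  let ?a = "(real N - 1) * p" and ?b = "(real (card S) - 1) * D"
  have "(\<Sum>i\<in>{1..N}. weighted_degree N (planted p D S) i * weighted_degree N (planted p D S) i) =
      (\<Sum>i\<in>{1..N}. ?a\<^sup>2 + of_bool (i \<in> S) * (2 * ?a * ?b + ?b\<^sup>2))"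
  proof (intro sum.cong refl)
    fix i assume "i \<in> {1..N}"
    have "(a + of_bool Q * b) * (a + of_bool Q * b) = a\<^sup>2 + of_bool Q * (2 * a * b + b\<^sup>2)"
      for a b :: real and Q
      by (cases Q) (simp_all add: power2_eq_square algebra_simps)
    then show "weighted_degree N (planted p D S) i * weighted_degree N (planted p D S) i =
        ?a\<^sup>2 + of_bool (i \<in> S) * (2 * ?a * ?b + ?b\<^sup>2)"
      unfolding weighted_degree_planted[OF assms \<open>i \<in> {1..N}\<close>] .
  qed
  also have "\<dots> = real N * ?a\<^sup>2 + real (card S) * (2 * ?a * ?b + ?b\<^sup>2)"
    unfolding sum.distrib sum_of_bool_subset[OF assms] by simp
  finally show ?thesis .
qed

text \<open>The vanishing row sums remove every term containing \<open>p\<close>. For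
  \<open>D = 0\<close> the value is 0, the mean under the null.\<close>

lemma mean_statistic_planted:
  assumes "S \<subseteq> {1..N}" "card S = n"
  shows "mean_statistic N (planted p D S) =
    D\<^sup>2 * (real n * (real n - 1) * (real n - 2) * (real N - real n)) / ((real N - 2) * (real N + 1))"
proof -
  define r k where "r = real N" and "k = real n"
  have "(r + 1) * (r * ((r - 1) * p)\<^sup>2 + k * (2 * ((r - 1) * p) * ((k - 1) * D) + ((k - 1) * D)\<^sup>2))
      - 4 * (r * (r - 1) / 2 * p + k * (k - 1) / 2 * D) * (r * (r - 1) / 2 * p + k * (k - 1) / 2 * D)
      - 2 * (r - 1) * (r * (r - 1) / 2 * p\<^sup>2 + k * (k - 1) / 2 * (2 * p * D + D\<^sup>2)) =
      D\<^sup>2 * (k * (k - 1) * (k - 2) * (r - k))"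
    by (simp add: power2_eq_square field_simps)
  then show ?thesis
    unfolding mean_statistic_def edge_kernel_form sum_weighted_degree_planted_square[OF assms(1)]
      sum_planted[OF assms(1)] sum_planted_square[OF assms(1)] num_pairs_def assms(2)
      r_def k_def by simp
qed

text \<open>By the vanishing row sums the background \<open>p\<close> drops out and only the profile
  \<open>planted 0 D S\<close> contributes.\<close>

lemma sum_edge_kernel_planted:
  assumes "S \<subseteq> {1..N}" "card S = n" "e \<in> edges N"
  shows "(\<Sum>f\<in>edges N. edge_kernel N e f * planted p D S f) =
    D * ((real N + 1) * (real n - 1) * (of_bool (fst e \<in> S) + of_bool (snd e \<in> S))
      - 2 * real n * (real n - 1) - 2 * (real N - 1) * (of_bool (fst e \<in> S) * of_bool (snd e \<in> S)))
    / ((real N - 2) * (real N + 1))"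
proof -
  have e: "fst e \<in> {1..N}" "snd e \<in> {1..N}"
    using assms(3) by (auto simp: edges_def)
  have "(\<Sum>f\<in>edges N. edge_kernel N e f * planted p D S f) =
      (\<Sum>f\<in>edges N. edge_kernel N e f * planted 0 D S f) + (\<Sum>f\<in>edges N. edge_kernel N e f * p)"
    by (simp add: planted_def distrib_left sum.distrib)
  also have "\<dots> = (\<Sum>f\<in>edges N. edge_kernel N e f * planted 0 D S f)"
    by (simp add: sum_edge_kernel_const[OF assms(3)])
  also have "\<dots> = ((real N + 1) * (of_bool (fst e \<in> S) * ((real n - 1) * D)
        + of_bool (snd e \<in> S) * ((real n - 1) * D))
      - 4 * (real n * (real n - 1) / 2 * D)
      - 2 * (real N - 1) * (D * of_bool (fst e \<in> S \<and> snd e \<in> S))) / ((real N - 2) * (real N + 1))"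
    unfolding sum_edge_kernel[OF assms(3)] weighted_degree_planted[OF assms(1) e(1)]
      weighted_degree_planted[OF assms(1) e(2)] sum_planted[OF assms(1)] assms(2) num_pairs_def
    by (simp add: planted_def)
  also have "\<dots> = D * ((real N + 1) * (real n - 1) * (of_bool (fst e \<in> S) + of_bool (snd e \<in> S))
      - 2 * real n * (real n - 1) - 2 * (real N - 1) * (of_bool (fst e \<in> S) * of_bool (snd e \<in> S)))
    / ((real N - 2) * (real N + 1))"
    by (rule arg_cong2[where f = "(/)"]) (simp_all add: field_simps)
  finally show ?thesis .
qed

text \<open>The 1/8 comes from (n - 1)(n - 2) \<ge> n^2/4 for \<open>n \<ge> 4\<close> and N - n
  \<ge> N/2 for \<open>2 * n \<le> N\<close>, together with (N - 2)(N + 1) \<le> N^2.\<close>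

lemma mean_statistic_planted_ge:
  assumes "S \<subseteq> {1..N}" "card S = n" "n \<ge> 4" "2 * n \<le> N"
  shows "real n ^ 3 * D\<^sup>2 / real N / 8 \<le> mean_statistic N (planted p D S)"
proof -
  define r k where "r = real N" and "k = real n"
  have k: "k \<ge> 4" "2 * k \<le> r" using assms(3,4) by (simp_all add: r_def k_def)
  have kk: "k\<^sup>2 / 4 \<le> (k - 1) * (k - 2)"
  proof -
    have "4 * k \<le> k * k" using k by (intro mult_right_mono) auto
    moreover have "(k - 1) * (k - 2) = k * k - 3 * k + 2" by (simp add: algebra_simps)
    ultimately show ?thesis using k unfolding power2_eq_square by linarith
  qed
  have "k ^ 3 * r / 8 = k * (k\<^sup>2 / 4) * (r / 2)"
    by (simp add: power2_eq_square power3_eq_cube)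
  also have "\<dots> \<le> k * ((k - 1) * (k - 2)) * (r - k)"
    using k kk by (intro mult_mono mult_nonneg_nonneg) auto
  finally have num: "k ^ 3 * r / 8 \<le> k * (k - 1) * (k - 2) * (r - k)"
    by (simp add: mult.assoc)
  have den: "0 < (r - 2) * (r + 1)" "(r - 2) * (r + 1) \<le> r\<^sup>2"
    using k by (simp, simp add: power2_eq_square algebra_simps)
  have "k ^ 3 * D\<^sup>2 / r / 8 = D\<^sup>2 * (k ^ 3 * r / 8) / r\<^sup>2"
    using k by (simp add: power2_eq_square field_simps)
  also have "\<dots> \<le> D\<^sup>2 * (k * (k - 1) * (k - 2) * (r - k)) / ((r - 2) * (r + 1))"
    using num den k by (intro frac_le mult_left_mono mult_nonneg_nonneg) auto
  finally show ?thesis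
    unfolding mean_statistic_planted[OF assms(1,2)] r_def k_def .
qed

section \<open>Bounds for the second moment under planted probabilities\<close>

lemma square_sum_le: "(a + b)\<^sup>2 \<le> 2 * a\<^sup>2 + 2 * (b :: real)\<^sup>2"
  using zero_le_power2[of "a - b"] by (simp add: power2_sum power2_diff)

text \<open>The two squares arise from bounding the bracket in \<open>sum_edge_kernel_planted\<close> from above
  and from below.\<close>

lemma sum_edge_kernel_planted_square_le:
  assumes "S \<subseteq> {1..N}" "card S = n" "e \<in> edges N" "N \<ge> 4" "2 \<le> n" "n \<le> N" "0 \<le> D"
  shows "(2 * (\<Sum>f\<in>edges N. edge_kernel N e f * planted p D S f))\<^sup>2 \<le>
    32 * D\<^sup>2 * (real n)\<^sup>2 / (real N)\<^sup>2 * (of_bool (fst e \<in> S) + of_bool (snd e \<in> S)) +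
    64 * D\<^sup>2 * real n ^ 4 / real N ^ 4"
proof -
  define r k a b :: real where "r = real N" and "k = real n"
    and "a = of_bool (fst e \<in> S)" and "b = of_bool (snd e \<in> S)"
  define c where "c = (r - 2) * (r + 1)"
  have r: "r \<ge> 4" "2 \<le> k" "k \<le> r" using assms(4-6) by (simp_all add: r_def k_def)
  have c: "0 < r\<^sup>2 / 2" "r\<^sup>2 / 2 \<le> c"
    using denominator_ge[OF assms(4)] r by (simp_all add: c_def r_def)
  define B where "B = (r + 1) * (k - 1) * (a + b) - 2 * k * (k - 1) - 2 * (r - 1) * (a * b)"
  have ab: "a \<in> {0, 1}" "b \<in> {0, 1}" by (auto simp: a_def b_def)
  have upper: "B \<le> (r + 1) * k * (a + b)"
  proof -
    have "B \<le> (r + 1) * (k - 1) * (a + b)"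
    proof -
      have "0 \<le> 2 * k * (k - 1)" "0 \<le> 2 * (r - 1) * (a * b)"
        using ab r by auto
      then show ?thesis unfolding B_def by linarith
    qed
    also have "\<dots> \<le> (r + 1) * k * (a + b)"
      using ab r by (intro mult_right_mono mult_left_mono) auto
    finally show ?thesis .
  qed
  \<comment> \<open>By \<open>2 \<le> k\<close> the last term of \<open>B\<close> is absorbed by the
    first, so only \<open>- 2 * k * (k - 1)\<close> can make \<open>B\<close> negative.\<close>
  have lower: "- B \<le> 2 * k\<^sup>2"
  proof -
    have "(r - 1) * 1 \<le> (r + 1) * (k - 1)" using r by (intro mult_mono) auto
    then have "2 * (r - 1) * (a * b) \<le> (r + 1) * (k - 1) * (a + b)"
      using ab r by auto
    then show ?thesis
      using r by (simp add: B_def power2_eq_square right_diff_distrib)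
  qed
  have "\<bar>B\<bar> \<le> max ((r + 1) * k * (a + b)) (2 * k\<^sup>2)"
    using upper lower by linarith
  then have "B\<^sup>2 \<le> (max ((r + 1) * k * (a + b)) (2 * k\<^sup>2))\<^sup>2"
    by (metis abs_ge_zero power2_abs power_mono)
  also have "\<dots> \<le> ((r + 1) * k * (a + b))\<^sup>2 + (2 * k\<^sup>2)\<^sup>2"
    by (simp add: max_def)
  \<comment> \<open>Here \<open>a + b\<close> is 0, 1 or 2. A bound linear in \<open>a + b\<close>
    is wanted because its sum over edges is a sum of weighted degrees.\<close>
  also have "((r + 1) * k * (a + b))\<^sup>2 \<le> (r + 1)\<^sup>2 * k\<^sup>2 * (2 * (a + b))"
  proof -
    have "(a + b)\<^sup>2 \<le> 2 * (a + b)" using ab by auto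
    then show ?thesis unfolding power_mult_distrib by (intro mult_left_mono) auto
  qed
  finally have B2: "B\<^sup>2 \<le> 2 * (r + 1)\<^sup>2 * k\<^sup>2 * (a + b) + 4 * k ^ 4"
    by (simp add: algebra_simps)
  have "(2 * (\<Sum>f\<in>edges N. edge_kernel N e f * planted p D S f))\<^sup>2 = 4 * D\<^sup>2 * B\<^sup>2 / c\<^sup>2"
    unfolding sum_edge_kernel_planted[OF assms(1-3)] B_def c_def a_def b_def r_def k_def
    by (simp add: power_mult_distrib power_divide)
  also have "\<dots> \<le> 4 * D\<^sup>2 * (2 * (r + 1)\<^sup>2 * k\<^sup>2 * (a + b) + 4 * k ^ 4) / c\<^sup>2"
    using B2 by (intro divide_right_mono mult_left_mono) auto
  also have "\<dots> = 8 * D\<^sup>2 * k\<^sup>2 * (a + b) * ((r + 1) / c)\<^sup>2 + 16 * D\<^sup>2 * k ^ 4 * (1 / c)\<^sup>2"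
  proof -
    have "4 * x * (2 * R\<^sup>2 * y * z + 4 * w) / c\<^sup>2 = 8 * x * y * z * (R / c)\<^sup>2 + 16 * x * w * (1 / c)\<^sup>2"
      for x y z w R :: real
      by (simp add: power_divide add_divide_distrib distrib_left ac_simps)
    then show ?thesis .
  qed
  also have "\<dots> \<le> 8 * D\<^sup>2 * k\<^sup>2 * (a + b) * (2 / r)\<^sup>2 + 16 * D\<^sup>2 * k ^ 4 * (2 / r\<^sup>2)\<^sup>2"
  proof -
    have "(r + 1) / c = 1 / (r - 2)" using r by (simp add: c_def)
    also have "\<dots> \<le> 1 / (r / 2)" using r by (intro divide_left_mono) auto
    finally have "(r + 1) / c \<le> 2 / r" by simp
    moreover have "1 / c \<le> 2 / r\<^sup>2"
    proof -
      have "1 / c \<le> 1 / (r\<^sup>2 / 2)"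
        using c by (intro divide_left_mono mult_pos_pos) linarith+
      then show ?thesis by simp
    qed
    moreover have "0 \<le> (r + 1) / c" "0 \<le> 1 / c"
      using c r by (auto intro!: divide_nonneg_nonneg order_trans[OF _ c(2)])
    ultimately show ?thesis
      using ab by (intro add_mono mult_left_mono power_mono) auto
  qed
  also have "\<dots> = 32 * D\<^sup>2 * k\<^sup>2 / r\<^sup>2 * (a + b) + 64 * D\<^sup>2 * k ^ 4 / r ^ 4"
    by (simp add: power_divide)
  finally show ?thesis
    by (simp add: a_def b_def r_def k_def)
qed

text \<open>Summing endpoint indicators against edge probabilities gives the expected degrees of the
  community members. Their background part leads to a multiple of n^3 D^2 q / N, their community
  part to the term cubic in \<open>D\<close>. Here \<open>q\<close> is the average edge
  probability.\<close>

lemma weighted_sum_edge_kernel_planted_square_le: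
  assumes "S \<subseteq> {1..N}" "card S = n" "N \<ge> 4" "2 \<le> n" "n \<le> N" "0 \<le> D" "0 \<le> p"
    and q: "q = p + D * (num_pairs n / num_pairs N)"
  shows "(\<Sum>e\<in>edges N. planted p D S e *
      (2 * (\<Sum>f\<in>edges N. edge_kernel N e f * planted p D S f))\<^sup>2) \<le>
    64 * (real n ^ 3 * D\<^sup>2 / real N) * q + 32 * D ^ 3 * real n ^ 4 / (real N)\<^sup>2"
proof -
  let ?P = "planted p D S"
  define r k where "r = real N" and "k = real n"
  have r: "r \<ge> 4" "2 \<le> k" "k \<le> r" using assms(3-5) by (simp_all add: r_def k_def)
  define u v where "u = 32 * D\<^sup>2 * k\<^sup>2 / r\<^sup>2" and "v = 64 * D\<^sup>2 * k ^ 4 / r ^ 4"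
  have uv: "0 \<le> u" "0 \<le> v" using r by (simp_all add: u_def v_def)
  have P0: "0 \<le> ?P e" for e using assms(6,7) by (simp add: planted_def)
  have M: "num_pairs N > 0" using assms(3) by (intro num_pairs_pos) simp
  have nn: "num_pairs n \<ge> 0" using r by (simp add: num_pairs_def k_def)
  have pq: "p \<le> q" unfolding q using M nn assms(6) by simp
  have sumP: "(\<Sum>e\<in>edges N. ?P e) = num_pairs N * q"
    unfolding sum_planted[OF assms(1)] assms(2) q using M by (simp add: field_simps)
  have "(\<Sum>e\<in>edges N. ?P e * (2 * (\<Sum>f\<in>edges N. edge_kernel N e f * ?P f))\<^sup>2) \<le>
      (\<Sum>e\<in>edges N. ?P e * (u * (of_bool (fst e \<in> S) + of_bool (snd e \<in> S)) + v))"
    unfolding u_def v_def r_def k_def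
    by (intro sum_mono mult_left_mono sum_edge_kernel_planted_square_le P0 assms)
  also have "\<dots> = u * (\<Sum>e\<in>edges N. (of_bool (fst e \<in> S) + of_bool (snd e \<in> S)) * ?P e) +
      v * (\<Sum>e\<in>edges N. ?P e)"
  proof -
    have "x * (u * y + v) = u * (y * x) + v * x" for x y u v :: real
      by (simp add: algebra_simps)
    then show ?thesis
      by (simp only: sum.distrib sum_distrib_left)
  qed
  also have "(\<Sum>e\<in>edges N. (of_bool (fst e \<in> S) + of_bool (snd e \<in> S)) * ?P e) =
      (\<Sum>i\<in>{1..N}. of_bool (i \<in> S) * weighted_degree N ?P i)"
    by (rule sum_weighted_degree[symmetric])
  also have "\<dots> = (\<Sum>i\<in>{1..N}. of_bool (i \<in> S) * ((r - 1) * p + (k - 1) * D))"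
    using weighted_degree_planted[OF assms(1)] assms(2)
    by (intro sum.cong refl) (simp add: r_def k_def)
  also have "\<dots> = k * ((r - 1) * p + (k - 1) * D)"
    unfolding sum_of_bool_subset[OF assms(1)] by (simp add: assms(2) k_def)
  also have "\<dots> \<le> k * (r * q + k * D)"
    using r pq assms(6,7) by (intro mult_left_mono add_mono mult_mono) auto
  also have "v * (\<Sum>e\<in>edges N. ?P e) \<le> v * (r\<^sup>2 / 2 * q)"
    unfolding sumP using num_pairs_le[of N] pq assms(7) r
    using uv by (intro mult_left_mono mult_right_mono) (auto simp: r_def)
  also have "v * (r\<^sup>2 / 2 * q) = 32 * D\<^sup>2 * k ^ 3 * q * k / r\<^sup>2"
    using r by (simp add: v_def field_simps power_numeral_reduce)
  \<comment> \<open>By \<open>k \<le> r\<close> this uniform part obeys the same bound as the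
    background part; 32 from each make the 64.\<close>
  also have "\<dots> \<le> 32 * D\<^sup>2 * k ^ 3 * q * r / r\<^sup>2"
    using r pq assms(7) by (intro divide_right_mono mult_left_mono mult_nonneg_nonneg) auto
  also have "u * (k * (r * q + k * D)) + 32 * D\<^sup>2 * k ^ 3 * q * r / r\<^sup>2 =
      64 * (k ^ 3 * D\<^sup>2 / r) * q + 32 * D ^ 3 * k ^ 4 / r\<^sup>2"
    using r by (simp add: u_def field_simps power_numeral_reduce)
  finally show ?thesis
    using uv by (simp add: r_def k_def mult_left_mono)
qed

lemma sum_weighted_degree_planted_square_le:
  assumes "S \<subseteq> {1..N}" "card S = n" "N \<ge> 1" "1 \<le> n"
  shows "(\<Sum>i\<in>{1..N}. (weighted_degree N (planted p D S) i)\<^sup>2) \<le>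
    2 * real N ^ 3 * p\<^sup>2 + 2 * real n ^ 3 * D\<^sup>2"
proof -
  define r k where "r = real N" and "k = real n"
  have r: "r \<ge> 1" "1 \<le> k" using assms(3,4) by (simp_all add: r_def k_def)
  have "(\<Sum>i\<in>{1..N}. (weighted_degree N (planted p D S) i)\<^sup>2) \<le>
      (\<Sum>i\<in>{1..N}. 2 * (r\<^sup>2 * p\<^sup>2) + of_bool (i \<in> S) * (2 * (k\<^sup>2 * D\<^sup>2)))"
  proof (rule sum_mono)
    fix i assume i: "i \<in> {1..N}"
    have "(weighted_degree N (planted p D S) i)\<^sup>2 \<le>
        2 * ((r - 1) * p)\<^sup>2 + 2 * (of_bool (i \<in> S) * ((k - 1) * D))\<^sup>2"
      unfolding weighted_degree_planted[OF assms(1) i] assms(2) r_def k_def by (rule square_sum_le)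
    also have "\<dots> = 2 * ((r - 1)\<^sup>2 * p\<^sup>2) + of_bool (i \<in> S) * (2 * ((k - 1)\<^sup>2 * D\<^sup>2))"
      by (simp add: power_mult_distrib)
    also have "\<dots> \<le> 2 * (r\<^sup>2 * p\<^sup>2) + of_bool (i \<in> S) * (2 * (k\<^sup>2 * D\<^sup>2))"
      using r by (intro add_mono mult_left_mono mult_right_mono power_mono) auto
    finally show "(weighted_degree N (planted p D S) i)\<^sup>2 \<le>
        2 * (r\<^sup>2 * p\<^sup>2) + of_bool (i \<in> S) * (2 * (k\<^sup>2 * D\<^sup>2))" .
  qed
  also have "\<dots> = r * (2 * (r\<^sup>2 * p\<^sup>2)) + k * (2 * (k\<^sup>2 * D\<^sup>2))"
    unfolding sum.distrib sum_of_bool_subset[OF assms(1)] assms(2) by (simp add: r_def k_def)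
  also have "\<dots> = 2 * r ^ 3 * p\<^sup>2 + 2 * k ^ 3 * D\<^sup>2"
    by (simp add: power_numeral_reduce)
  finally show ?thesis by (simp add: r_def k_def)
qed

text \<open>The linear part yields the last two terms. The quadratic part yields twice the sum of
  \<open>2 N q^2 + 2 s / N\<close> from the degrees and \<open>16 N q^2\<close> from the total,
  hence 36 = 2 (2 + 16). For \<open>D = 0\<close> only \<open>36 N q^2\<close> remains.\<close>

lemma second_moment_planted:
  assumes "S \<subseteq> {1..N}" "card S = n" "N \<ge> 4" "2 \<le> n" "n \<le> N" "0 \<le> D" "0 \<le> p" "p + D \<le> 1"
    and q: "q = p + D * (num_pairs n / num_pairs N)"
    and s: "s = real n ^ 3 * D\<^sup>2 / real N"
  shows "measure_pmf.expectation (bernoulli_product (edges N) (planted p D S))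
      (\<lambda>\<xi>. (V2 N (adjacency \<xi>) - V1 N (adjacency \<xi>) - mean_statistic N (planted p D S))\<^sup>2) \<le>
    36 * real N * q\<^sup>2 + 4 * s / real N + 64 * s * q + 32 * D ^ 3 * real n ^ 4 / (real N)\<^sup>2"
proof -
  let ?P = "planted p D S"
  define r k where "r = real N" and "k = real n"
  have r: "r \<ge> 4" "2 \<le> k" "k \<le> r" using assms(3-5) by (simp_all add: r_def k_def)
  have P: "0 \<le> ?P e \<and> ?P e \<le> 1" for e using assms(6-8) by (simp add: planted_def)
  have M: "num_pairs N > 0" using assms(3) by (intro num_pairs_pos) simp
  have nn: "num_pairs n \<ge> 0" using r by (simp add: num_pairs_def k_def)
  have pq: "p \<le> q" unfolding q using M nn assms(6) by simp
  have sumP: "(\<Sum>e\<in>edges N. ?P e) = num_pairs N * q"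
    unfolding sum_planted[OF assms(1)] assms(2) q using M by (simp add: field_simps)
  have "(\<Sum>i\<in>{1..N}. (weighted_degree N ?P i)\<^sup>2) / r\<^sup>2 \<le> (2 * r ^ 3 * p\<^sup>2 + 2 * k ^ 3 * D\<^sup>2) / r\<^sup>2"
    unfolding r_def k_def using assms(3,4)
    by (intro divide_right_mono sum_weighted_degree_planted_square_le assms(1,2)) auto
  also have "\<dots> = 2 * r * p\<^sup>2 + 2 * s / r"
    unfolding s using r by (simp add: field_simps power_numeral_reduce flip: r_def k_def)
  also have "\<dots> \<le> 2 * r * q\<^sup>2 + 2 * s / r"
    using pq assms(7) r by (intro add_mono mult_left_mono power_mono) auto
  finally have deg: "(\<Sum>i\<in>{1..N}. (weighted_degree N ?P i)\<^sup>2) / r\<^sup>2 \<le> 2 * r * q\<^sup>2 + 2 * s / r" .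
  have "64 / r ^ 4 * (\<Sum>e\<in>edges N. ?P e)\<^sup>2 \<le> 64 / r ^ 4 * (r\<^sup>2 / 2 * q)\<^sup>2"
    unfolding sumP using num_pairs_le[of N] pq assms(7) M
    by (intro mult_left_mono power_mono mult_right_mono) (auto simp: r_def)
  also have "\<dots> = 16 * q\<^sup>2"
    using r by (simp add: field_simps power_numeral_reduce)
  also have "\<dots> \<le> 16 * r * q\<^sup>2"
    using r by (intro mult_right_mono) auto
  finally have tot: "64 / r ^ 4 * (\<Sum>e\<in>edges N. ?P e)\<^sup>2 \<le> 16 * r * q\<^sup>2" .
  have "measure_pmf.expectation (bernoulli_product (edges N) ?P)
      (\<lambda>\<xi>. (V2 N (adjacency \<xi>) - V1 N (adjacency \<xi>) - mean_statistic N ?P)\<^sup>2) \<le>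
    (\<Sum>e\<in>edges N. ?P e * (2 * (\<Sum>f\<in>edges N. edge_kernel N e f * ?P f))\<^sup>2) +
    2 * ((\<Sum>i\<in>{1..N}. (weighted_degree N ?P i)\<^sup>2) / r\<^sup>2 + 64 / r ^ 4 * (\<Sum>e\<in>edges N. ?P e)\<^sup>2)"
    unfolding r_def using assms(3) P by (intro second_moment_V2_minus_V1)
  also have "(\<Sum>e\<in>edges N. ?P e * (2 * (\<Sum>f\<in>edges N. edge_kernel N e f * ?P f))\<^sup>2) \<le>
      64 * s * q + 32 * D ^ 3 * k ^ 4 / r\<^sup>2"
    unfolding s r_def k_def
    by (intro weighted_sum_edge_kernel_planted_square_le assms)
  also have "(\<Sum>i\<in>{1..N}. (weighted_degree N ?P i)\<^sup>2) / r\<^sup>2 + 64 / r ^ 4 * (\<Sum>e\<in>edges N. ?P e)\<^sup>2 \<le>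
      (2 * r * q\<^sup>2 + 2 * s / r) + 16 * r * q\<^sup>2"
    using deg tot by (rule add_mono)
  finally have "measure_pmf.expectation (bernoulli_product (edges N) ?P)
      (\<lambda>\<xi>. (V2 N (adjacency \<xi>) - V1 N (adjacency \<xi>) - mean_statistic N ?P)\<^sup>2) \<le>
    64 * s * q + 32 * D ^ 3 * k ^ 4 / r\<^sup>2 + 2 * ((2 * r * q\<^sup>2 + 2 * s / r) + 16 * r * q\<^sup>2)"
    by simp
  then show ?thesis
    by (simp add: r_def k_def)
qed

section \<open>Error probabilities\<close>

lemma random_graph_planted:
  assumes "\<And>i j. P i j = planted p D S (i, j)"
  shows "random_graph N P = map_pmf adjacency (bernoulli_product (edges N) (planted p D S))"
proof -
  have "(\<lambda>(i, j). bernoulli_pmf (P i j)) = (\<lambda>e. bernoulli_pmf (planted p D S e))"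
    by (auto simp: assms)
  then show ?thesis
    by (simp add: random_graph_def bernoulli_product_def)
qed

text \<open>With zero excess the law is the same for every \<open>S\<close>, so the planted
  estimates apply to the null with any set of size \<open>n\<close>.\<close>

lemma null_law_planted:
  "null_law N n p0' p1 =
    map_pmf adjacency (bernoulli_product (edges N) (planted (null_prob N n p0' p1) 0 S))"
  unfolding null_law_def by (rule random_graph_planted) (simp add: planted_def)

lemma alt_law_planted:
  "alt_law N p0' p1 S = map_pmf adjacency (bernoulli_product (edges N) (planted p0' (p1 - p0') S))"
  unfolding alt_law_def by (rule random_graph_planted) (simp add: planted_def)

text \<open>The expected number of edges is \<open>num_pairs N * q\<close> and its variance is at
  most the same number; Chebyshev's inequality at half the mean gives the bound. Fixing the expected
  total degree means that \<open>q\<close> agrees under both hypotheses.\<close>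

lemma prob_p0_hat_deviation:
  assumes "S \<subseteq> {1..N}" "card S = n" "N \<ge> 2" "0 \<le> D" "0 \<le> p" "p + D \<le> 1"
    and q: "q = p + D * (num_pairs n / num_pairs N)" and "0 < q"
  shows "measure_pmf.prob (bernoulli_product (edges N) (planted p D S))
      {\<xi>. q / 2 \<le> \<bar>p0_hat N (adjacency \<xi>) - q\<bar>} \<le> 4 / (num_pairs N * q)"
proof -
  let ?P = "planted p D S"
  define M where "M = num_pairs N"
  have M: "M > 0" unfolding M_def using assms(3) by (rule num_pairs_pos)
  have P: "0 \<le> ?P e \<and> ?P e \<le> 1" for e using assms(4-6) by (simp add: planted_def)
  have sumP: "(\<Sum>e\<in>edges N. ?P e) = M * q"
    unfolding sum_planted[OF assms(1)] assms(2) q using M by (simp add: field_simps M_def)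
  \<comment> \<open>The terms \<open>0 +\<close> and \<open>1 *\<close> give the sum the shape of
    \<open>second_moment_linear_form\<close>.\<close>
  let ?F = "\<lambda>\<xi>. 0 + (\<Sum>e\<in>edges N. 1 * centered ?P \<xi> e)"
  have F: "?F \<xi> = M * (p0_hat N (adjacency \<xi>) - q)" for \<xi>
    using M sumP
    by (simp add: centered_def sum_subtractf p0_hat_def total_degree_adjacency M_def[symmetric]
        right_diff_distrib)
  have "measure_pmf.prob (bernoulli_product (edges N) ?P)
      {\<xi>. q / 2 \<le> \<bar>p0_hat N (adjacency \<xi>) - q\<bar>} \<le>
    measure_pmf.expectation (bernoulli_product (edges N) ?P) (\<lambda>\<xi>. (?F \<xi>)\<^sup>2) / (M * (q / 2))\<^sup>2"
  proof (rule prob_le_second_moment)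
    fix \<xi> assume "\<xi> \<in> {\<xi>. q / 2 \<le> \<bar>p0_hat N (adjacency \<xi>) - q\<bar>}"
    then show "M * (q / 2) \<le> \<bar>?F \<xi>\<bar>"
      unfolding F abs_mult using M by simp
  qed (use M assms(8) in auto)
  also have "measure_pmf.expectation (bernoulli_product (edges N) ?P) (\<lambda>\<xi>. (?F \<xi>)\<^sup>2) =
      0\<^sup>2 + (\<Sum>e\<in>edges N. 1\<^sup>2 * (?P e * (1 - ?P e)))"
    using P by (intro second_moment_linear_form) auto
  also have "\<dots> \<le> (\<Sum>e\<in>edges N. ?P e)"
    using P by (auto intro!: sum_mono mult_left_le)
  also have "\<dots> / (M * (q / 2))\<^sup>2 = 4 / (M * q)"
    unfolding sumP using M assms(8) by (simp add: field_simps power2_eq_square)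
  finally show ?thesis
    by (simp add: divide_right_mono M_def)
qed

text \<open>Positivity of the estimate excludes the default value of \<open>V_star\<close> and
  allows clearing denominators; the quadratic form is then compared with a threshold proportional to
  the estimate.\<close>

lemma V_star_ge_iff:
  assumes "p0_hat N w > 0" "q > 0" "N > 0"
  shows "s / (32 * sqrt (real N) * q) \<le> V_star N w \<longleftrightarrow> s * p0_hat N w / (32 * q) \<le> V2 N w - V1 N w"
  using assms by (simp add: V_star_def divide_simps mult.commute mult.left_commute)

text \<open>When the estimate lies between \<open>q / 2\<close> and \<open>3 * q / 2\<close>, the
  test compares \<open>V2 - V1\<close> with a number between s/64 and 3s/64. A null error then needs
  a deviation of s/64 from the mean 0, and an alternative error one of s/16 from a mean of at least
  s/8, as 3s/64 < s/16.\<close>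

lemma risk_le:
  assumes "4 \<le> n" "2 * n \<le> N" "0 < p" "p \<le> p1" "p1 < 1"
    and D: "D = p1 - p"
    and q: "q = null_prob N n p p1"
    and s: "s = real n ^ 3 * D\<^sup>2 / real N" "s > 0"
  defines "t \<equiv> s / (32 * sqrt (real N) * q)"
  shows "risk N n p p1 (degree_variance_test N t) \<le>
    8 / (num_pairs N * q) + 36 * real N * q\<^sup>2 / (s / 64)\<^sup>2 +
    (36 * real N * q\<^sup>2 + 4 * s / real N + 64 * s * q + 32 * D ^ 3 * real n ^ 4 / (real N)\<^sup>2) / (s / 16)\<^sup>2"
proof -
  have N: "N \<ge> 4" "n \<le> N" "N \<ge> 2" "N > 0" "2 \<le> n" using assms(1,2) by auto
  have D0: "0 \<le> D" "p + D \<le> 1" using assms(4,5) D by auto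
  have M: "num_pairs N > 0" using N(3) by (rule num_pairs_pos)
  have nn: "num_pairs n \<ge> 0" "num_pairs n \<le> num_pairs N"
    using N by (auto simp: num_pairs_def intro!: mult_mono)
  have q': "q = p + D * (num_pairs n / num_pairs N)"
    by (simp add: q null_prob_def D)
  have ratio: "0 \<le> num_pairs n / num_pairs N" "num_pairs n / num_pairs N \<le> 1"
    using M nn by (auto simp: divide_le_eq)
  have q0: "0 < q" "q \<le> 1"
  proof -
    show "0 < q" unfolding q' using assms(3) D0 ratio by (intro add_pos_nonneg mult_nonneg_nonneg)
    show "q \<le> 1" unfolding q' using D0 mult_left_le[OF ratio(2) D0(1)] by linarith
  qed
  let ?bad = "\<lambda>\<xi>. q / 2 \<le> \<bar>p0_hat N (adjacency \<xi>) - q\<bar>"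
  let ?U = "\<lambda>\<xi>. V2 N (adjacency \<xi>) - V1 N (adjacency \<xi>)"
  have good: "q / 2 < p0_hat N (adjacency \<xi>)" "p0_hat N (adjacency \<xi>) < 3 * q / 2"
    "t \<le> V_star N (adjacency \<xi>) \<longleftrightarrow> s * p0_hat N (adjacency \<xi>) / (32 * q) \<le> ?U \<xi>"
    if "\<not> ?bad \<xi>" for \<xi>
  proof -
    show 1: "q / 2 < p0_hat N (adjacency \<xi>)" "p0_hat N (adjacency \<xi>) < 3 * q / 2"
      using that by linarith+
    then show "t \<le> V_star N (adjacency \<xi>) \<longleftrightarrow> s * p0_hat N (adjacency \<xi>) / (32 * q) \<le> ?U \<xi>"
      unfolding t_def using q0 N by (intro V_star_ge_iff) linarith+
  qed
  have union: "measure_pmf.prob B A \<le> a + b"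
    if "A \<subseteq> A1 \<union> A2" "measure_pmf.prob B A1 \<le> a" "measure_pmf.prob B A2 \<le> b"
    for A A1 A2 :: "(nat \<times> nat \<Rightarrow> bool) set" and B a b
  proof -
    have "measure_pmf.prob B A \<le> measure_pmf.prob B (A1 \<union> A2)"
      using that(1) by (intro measure_pmf.finite_measure_mono) auto
    also have "\<dots> \<le> measure_pmf.prob B A1 + measure_pmf.prob B A2"
      by (rule measure_Un_le) auto
    finally show ?thesis using that by linarith
  qed
  have null: "measure_pmf.prob (null_law N n p p1) {w. degree_variance_test N t w = 1} \<le>
      4 / (num_pairs N * q) + 36 * real N * q\<^sup>2 / (s / 64)\<^sup>2"
  proof -
    \<comment> \<open>Any set of size \<open>n\<close> would do, as the null law has no
      community.\<close>
    define S where "S = {1..n}"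
    have S: "S \<subseteq> {1..N}" "card S = n" using N by (auto simp: S_def)
    let ?B = "bernoulli_product (edges N) (planted q 0 S)"
    have sub: "adjacency -` {w. degree_variance_test N t w = 1} \<subseteq>
        {\<xi>. ?bad \<xi>} \<union> {\<xi>. s / 64 \<le> \<bar>?U \<xi> - mean_statistic N (planted q 0 S)\<bar>}"
    proof (intro subsetI UnCI)
      fix \<xi> assume test: "\<xi> \<in> adjacency -` {w. degree_variance_test N t w = 1}"
        and "\<xi> \<notin> {\<xi>. s / 64 \<le> \<bar>?U \<xi> - mean_statistic N (planted q 0 S)\<bar>}"
      moreover have "mean_statistic N (planted q 0 S) = 0"
        by (simp add: mean_statistic_planted[OF S])
      ultimately have "\<bar>?U \<xi>\<bar> < s / 64" by (simp only: mem_Collect_eq not_le diff_zero)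
      then have U: "?U \<xi> < s / 64" by linarith
      show "\<xi> \<in> {\<xi>. ?bad \<xi>}"
      proof (rule ccontr)
        assume "\<xi> \<notin> {\<xi>. ?bad \<xi>}"
        then have nb: "\<not> ?bad \<xi>" by simp
        have "t \<le> V_star N (adjacency \<xi>)"
          using test by (simp add: degree_variance_test_def split: if_splits)
        then have "s * p0_hat N (adjacency \<xi>) / (32 * q) \<le> ?U \<xi>"
          using good(3)[OF nb] by simp
        moreover have "s * (q / 2) / (32 * q) \<le> s * p0_hat N (adjacency \<xi>) / (32 * q)"
          using good(1)[OF nb] q0 s(2) by (intro divide_right_mono mult_left_mono) auto
        moreover have "s * (q / 2) / (32 * q) = s / 64" using q0 by simp
        ultimately show False
          using U by linarith
      qed
    qed
    have "measure_pmf.prob ?B {\<xi>. s / 64 \<le> \<bar>?U \<xi> - mean_statistic N (planted q 0 S)\<bar>} \<le>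
        measure_pmf.expectation ?B (\<lambda>\<xi>. (?U \<xi> - mean_statistic N (planted q 0 S))\<^sup>2) / (s / 64)\<^sup>2"
      using s(2) by (intro prob_le_second_moment) auto
    \<comment> \<open>The planted bound at \<open>D = 0\<close>, where its own signal is 0 and its
      last three terms vanish.\<close>
    also have "\<dots> \<le> 36 * real N * q\<^sup>2 / (s / 64)\<^sup>2"
      using second_moment_planted[OF S N(1,5,2), of 0 q q 0] q0
      by (intro divide_right_mono) auto
    finally have "measure_pmf.prob ?B {\<xi>. s / 64 \<le> \<bar>?U \<xi> - mean_statistic N (planted q 0 S)\<bar>} \<le>
        36 * real N * q\<^sup>2 / (s / 64)\<^sup>2" .
    moreover have "measure_pmf.prob ?B {\<xi>. ?bad \<xi>} \<le> 4 / (num_pairs N * q)"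
      using prob_p0_hat_deviation[OF S N(3), of 0 q q] q0 by simp
    ultimately show ?thesis
      unfolding null_law_planted[where S = S] q[symmetric] measure_map_pmf
      by (intro union[OF sub])
  qed
  have alt: "measure_pmf.prob (alt_law N p p1 S) {w. degree_variance_test N t w = 0} \<le>
      4 / (num_pairs N * q) +
      (36 * real N * q\<^sup>2 + 4 * s / real N + 64 * s * q + 32 * D ^ 3 * real n ^ 4 / (real N)\<^sup>2)
        / (s / 16)\<^sup>2"
    if S: "S \<subseteq> {1..N}" "card S = n" for S
  proof -
    let ?B = "bernoulli_product (edges N) (planted p D S)"
    let ?\<mu> = "mean_statistic N (planted p D S)"
    have \<mu>: "s / 8 \<le> ?\<mu>"
      unfolding s(1) by (rule mean_statistic_planted_ge[OF S assms(1,2)])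
    have sub: "adjacency -` {w. degree_variance_test N t w = 0} \<subseteq>
        {\<xi>. ?bad \<xi>} \<union> {\<xi>. s / 16 \<le> \<bar>?U \<xi> - ?\<mu>\<bar>}"
    proof (intro subsetI UnCI)
      fix \<xi> assume test: "\<xi> \<in> adjacency -` {w. degree_variance_test N t w = 0}"
        and "\<xi> \<notin> {\<xi>. s / 16 \<le> \<bar>?U \<xi> - ?\<mu>\<bar>}"
      then have "\<bar>?U \<xi> - ?\<mu>\<bar> < s / 16" by simp
      then have U: "s / 16 < ?U \<xi>" using \<mu> by linarith
      show "\<xi> \<in> {\<xi>. ?bad \<xi>}"
      proof (rule ccontr)
        assume "\<xi> \<notin> {\<xi>. ?bad \<xi>}"
        then have nb: "\<not> ?bad \<xi>" by simp
        have "\<not> t \<le> V_star N (adjacency \<xi>)"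
          using test by (simp add: degree_variance_test_def split: if_splits)
        then have "?U \<xi> < s * p0_hat N (adjacency \<xi>) / (32 * q)"
          using good(3)[OF nb] by simp
        moreover have "s * p0_hat N (adjacency \<xi>) / (32 * q) \<le> s * (3 * q / 2) / (32 * q)"
          using good(2)[OF nb] q0 s(2) by (intro divide_right_mono mult_left_mono) auto
        moreover have "s * (3 * q / 2) / (32 * q) = 3 * s / 64" using q0 by simp
        ultimately show False
          using U s(2) by linarith
      qed
    qed
    have "measure_pmf.prob ?B {\<xi>. s / 16 \<le> \<bar>?U \<xi> - ?\<mu>\<bar>} \<le>
        measure_pmf.expectation ?B (\<lambda>\<xi>. (?U \<xi> - ?\<mu>)\<^sup>2) / (s / 16)\<^sup>2"
      using s(2) by (intro prob_le_second_moment) auto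
    also have "\<dots> \<le> (36 * real N * q\<^sup>2 + 4 * s / real N + 64 * s * q +
        32 * D ^ 3 * real n ^ 4 / (real N)\<^sup>2) / (s / 16)\<^sup>2"
      using second_moment_planted[OF S N(1,5,2) D0(1) _ D0(2) q' s(1)] assms(3)
      by (intro divide_right_mono) auto
    finally show ?thesis
      unfolding alt_law_planted D[symmetric] measure_map_pmf
      using prob_p0_hat_deviation[OF S N(3) D0(1) _ D0(2) q' q0(1)] assms(3)
      by (intro union[OF sub]) auto
  qed
  have "(MAX S\<in>{S. S \<subseteq> {1..N} \<and> card S = n}.
      measure_pmf.prob (alt_law N p p1 S) {w. degree_variance_test N t w = 0}) \<le>
      4 / (num_pairs N * q) +
      (36 * real N * q\<^sup>2 + 4 * s / real N + 64 * s * q + 32 * D ^ 3 * real n ^ 4 / (real N)\<^sup>2)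
        / (s / 16)\<^sup>2"
  proof (rule Max.boundedI)
    show "finite ((\<lambda>S. measure_pmf.prob (alt_law N p p1 S) {w. degree_variance_test N t w = 0}) `
        {S. S \<subseteq> {1..N} \<and> card S = n})"
      by (intro finite_imageI) simp
    have "{1..n} \<in> {S. S \<subseteq> {1..N} \<and> card S = n}" using N by auto
    then show "(\<lambda>S. measure_pmf.prob (alt_law N p p1 S) {w. degree_variance_test N t w = 0}) `
        {S. S \<subseteq> {1..N} \<and> card S = n} \<noteq> {}"
      by blast
  qed (use alt in auto)
  with null show ?thesis
    unfolding risk_def by simp
qed

text \<open>By \<open>n \<le> N\<close> the set of communities is nonempty, so the maximum dominates
  an actual probability.\<close>

lemma risk_nonneg:
  assumes "n \<le> N"
  shows "0 \<le> risk N n p0' p1 T"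
proof -
  let ?f = "\<lambda>S. measure_pmf.prob (alt_law N p0' p1 S) {w. T w = 0}"
  let ?A = "{S. S \<subseteq> {1..N} \<and> card S = n}"
  have "{1..n} \<in> ?A" using assms by auto
  then have "?f {1..n} \<le> Max (?f ` ?A)"
    by (intro Max_ge imageI finite_imageI) simp_all
  then have "0 \<le> Max (?f ` ?A)"
    using measure_nonneg order_trans by blast
  then show ?thesis
    by (simp add: risk_def)
qed

section \<open>Asymptotics\<close>

lemma num_pairs_ratio_le:
  assumes "2 \<le> n" "n \<le> N"
  shows "num_pairs n / num_pairs N \<le> (real n / real N)\<^sup>2"
proof -
  have n: "2 \<le> real n" "real n \<le> real N" using assms by simp_all
  have "num_pairs n / num_pairs N = (real n / real N) * ((real n - 1) / (real N - 1))"
    by (simp add: num_pairs_def)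
  also have "\<dots> \<le> (real n / real N) * (real n / real N)"
    using n by (intro mult_left_mono) (auto simp: divide_simps algebra_simps)
  finally show ?thesis by (simp add: power2_eq_square)
qed

text \<open>If \<open>q \<le> 2 * p\<close>, replacing \<open>p\<close> by \<open>q\<close> in the
  normalisation costs at most a factor 2. Otherwise the community provides more than half of
  \<open>q\<close>, which forces D \<ge> q N^2 / (2 n^2); with q N \<ge> C and N \<ge> n this gives
  the second bound.\<close>

lemma normalized_signal_ge:
  fixes p D q C :: real
  assumes "2 \<le> n" "n \<le> N" "0 < p" "0 \<le> D" "0 < C" "C / real N \<le> q"
    and q: "q = p + D * (num_pairs n / num_pairs N)"
  defines "R \<equiv> real n ^ 3 * D\<^sup>2 / real N / (sqrt (real N) * q)"
  shows "(D\<^sup>2 / p * (real n ^ 3 / (real N * sqrt (real N)))) / 2 \<le> R \<or> C * sqrt (real N) / 4 \<le> R"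
proof (cases "q \<le> 2 * p")
  case True
  define r k where "r = real N" and "k = real n"
  have r: "2 \<le> k" "k \<le> r" using assms(1,2) by (simp_all add: r_def k_def)
  have q0: "0 < q" using assms(5) r by (intro less_le_trans[OF _ assms(6)]) (simp add: r_def)
  have "(D\<^sup>2 / p * (k ^ 3 / (r * sqrt r))) / 2 = k ^ 3 * D\<^sup>2 / r / sqrt r / (2 * p)"
    by (simp add: ac_simps)
  also have "\<dots> \<le> k ^ 3 * D\<^sup>2 / r / sqrt r / q"
    using True q0 r by (intro divide_left_mono) auto
  also have "\<dots> = k ^ 3 * D\<^sup>2 / r / (sqrt r * q)"
    by simp
  finally show ?thesis by (simp add: R_def r_def k_def)
next
  case False
  define r k where "r = real N" and "k = real n"
  have r: "2 \<le> k" "k \<le> r" using assms(1,2) by (simp_all add: r_def k_def)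
  have q0: "0 < q" using False assms(3) by simp
  have sr: "sqrt r * sqrt r = r" "0 < sqrt r" using r by simp_all
  have "q \<le> p + D * (k / r)\<^sup>2"
    unfolding q r_def k_def using assms by (intro add_left_mono mult_left_mono num_pairs_ratio_le)
  with False have "q / 2 < D * (k / r)\<^sup>2" by simp
  then have "q * r\<^sup>2 / (2 * k\<^sup>2) \<le> D"
    using r by (simp add: field_simps)
  then have "(q * r\<^sup>2 / (2 * k\<^sup>2))\<^sup>2 \<le> D\<^sup>2"
    using q0 by (intro power_mono) auto
  then have "k ^ 3 * (q * r\<^sup>2 / (2 * k\<^sup>2))\<^sup>2 / r / (sqrt r * q) \<le> k ^ 3 * D\<^sup>2 / r / (sqrt r * q)"
    using q0 r by (intro divide_right_mono mult_left_mono) auto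
  also have "k ^ 3 * (q * r\<^sup>2 / (2 * k\<^sup>2))\<^sup>2 / r / (sqrt r * q) = q * r * (r / k) * r / (4 * sqrt r)"
    using q0 r by (simp add: field_simps power_numeral_reduce)
  also have "C * 1 * r / (4 * sqrt r) \<le> \<dots>"
    using assms(5,6) q0 r
    by (intro divide_right_mono mult_right_mono mult_mono) (auto simp: r_def field_simps)
  also have "C * 1 * r / (4 * sqrt r) = C * sqrt r / 4"
    using sr by (simp add: divide_simps)
  finally show ?thesis by (simp add: R_def r_def k_def)
qed

text \<open>If the gap \<open>p1 - p\<close> is at most \<open>p\<close>, its square over
  \<open>p\<close> is at most the gap, and n^3 / N^(3/2) \<le> n^2. Otherwise \<open>p1\<close> is
  less than twice the gap. Both lower bounds diverge in the application.\<close>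

lemma square_times_gap_ge:
  fixes p p1 :: real
  assumes "n \<le> N" "1 \<le> N" "0 < p" "p \<le> p1"
  shows "(p1 - p)\<^sup>2 / p * (real n ^ 3 / (real N * sqrt (real N))) \<le> (real n)\<^sup>2 * (p1 - p) \<or>
    (real n)\<^sup>2 * p1 / 2 \<le> (real n)\<^sup>2 * (p1 - p)"
proof (cases "p1 - p \<le> p")
  case True
  have "(p1 - p)\<^sup>2 / p \<le> p1 - p"
    using True assms mult_left_mono[of "p1 - p" p "p1 - p"]
    by (simp add: power2_eq_square divide_le_eq)
  moreover have "real n ^ 3 / (real N * sqrt (real N)) \<le> (real n)\<^sup>2"
  proof -
    have "real n ^ 3 \<le> (real n)\<^sup>2 * (real N * 1)"
      using assms by (simp add: power3_eq_cube power2_eq_square mult_left_mono)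
    also have "\<dots> \<le> (real n)\<^sup>2 * (real N * sqrt (real N))"
      using assms by (intro mult_left_mono) auto
    finally show ?thesis using assms by (simp add: divide_le_eq)
  qed
  ultimately have "(p1 - p)\<^sup>2 / p * (real n ^ 3 / (real N * sqrt (real N))) \<le> (p1 - p) * (real n)\<^sup>2"
    using assms by (intro mult_mono) auto
  then show ?thesis by (simp add: mult.commute)
next
  case False
  then have "(real n)\<^sup>2 * (p1 / 2) \<le> (real n)\<^sup>2 * (p1 - p)"
    by (intro mult_left_mono) auto
  then show ?thesis by simp
qed

text \<open>Substituting \<open>s = R * sqrt N * q\<close> expresses the error terms through
  diverging quantities. The constants are 36 (64^2 + 16^2) = 156672 and 16^2 times 4, 64 and
  32.\<close>

lemma risk_terms_le:
  fixes C D q :: real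
  assumes "1 \<le> n" "2 \<le> N" "0 < D" "0 < q" "0 < C" "C / real N \<le> q"
    and s: "s = real n ^ 3 * D\<^sup>2 / real N"
    and R: "R = s / (sqrt (real N) * q)"
  shows "8 / (num_pairs N * q) + 36 * real N * q\<^sup>2 / (s / 64)\<^sup>2 +
    (36 * real N * q\<^sup>2 + 4 * s / real N + 64 * s * q + 32 * D ^ 3 * real n ^ 4 / (real N)\<^sup>2) / (s / 16)\<^sup>2 \<le>
    32 / ((real N)\<^sup>2 * q) + 156672 / R\<^sup>2 + (1024 / C + 16384) / R + 8192 / ((real n)\<^sup>2 * D)"
proof -
  define r k where "r = real N" and "k = real n"
  have r: "1 \<le> k" "2 \<le> r" using assms(1,2) by (simp_all add: r_def k_def)
  define w where "w = sqrt r"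
  have w: "w * w = r" "1 \<le> w" using r by (simp_all add: w_def)
  have s0: "0 < s" unfolding s using assms r by (simp add: r_def k_def)
  have sR: "s = R * w * q" and R0: "0 < R"
    using R assms(4) s0 w by (simp_all flip: r_def w_def)
  have "r\<^sup>2 / 4 \<le> num_pairs N"
  proof -
    have "2 * r \<le> r * r" using r by (intro mult_right_mono) auto
    then show ?thesis by (simp add: num_pairs_def power2_eq_square right_diff_distrib r_def)
  qed
  then have "8 / (num_pairs N * q) \<le> 8 / (r\<^sup>2 / 4 * q)"
    using r assms(4) num_pairs_pos[OF assms(2)]
    by (intro divide_left_mono mult_right_mono mult_pos_pos) auto
  then have t1: "8 / (num_pairs N * q) \<le> 32 / (r\<^sup>2 * q)" by simp
  have var: "r * q\<^sup>2 / s\<^sup>2 = 1 / R\<^sup>2"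
  proof -
    have "w\<^sup>2 = r" using w by (simp add: power2_eq_square)
    then show ?thesis
      unfolding sR power_mult_distrib using assms(4) R0 r by simp
  qed
  have "1 / (r * s) = 1 / (R * (w * (r * q)))"
    unfolding sR by (simp add: ac_simps)
  also have "\<dots> \<le> 1 / (R * (1 * C))"
  proof -
    \<comment> \<open>The lower bound \<open>C / real N \<le> q\<close> enters here.\<close>
    have "C \<le> r * q" using assms(5,6) r by (simp add: r_def field_simps)
    then have "1 * C \<le> w * (r * q)" using w assms(5) by (intro mult_mono) auto
    then show ?thesis
      using R0 assms(4,5) w r by (intro divide_left_mono mult_left_mono mult_pos_pos) auto
  qed
  finally have t2: "1 / (r * s) \<le> 1 / (R * C)" by simp
  have "q / s = 1 / (R * w)"
    unfolding sR using assms(4) by simp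
  also have "\<dots> \<le> 1 / (R * 1)"
    using R0 w by (intro divide_left_mono mult_left_mono) auto
  finally have t3: "q / s \<le> 1 / R" by simp
  \<comment> \<open>An exact identity, since the square of \<open>s\<close> is k^6 D^4 /
    r^2.\<close>
  have t4: "D ^ 3 * k ^ 4 / r\<^sup>2 / s\<^sup>2 = 1 / (k\<^sup>2 * D)"
    unfolding s using r assms(3)
    by (simp add: field_simps power_numeral_reduce flip: r_def k_def)
  have "36 * r * q\<^sup>2 / (s / 64)\<^sup>2 +
      (36 * r * q\<^sup>2 + 4 * s / r + 64 * s * q + 32 * D ^ 3 * k ^ 4 / r\<^sup>2) / (s / 16)\<^sup>2 =
      156672 * (r * q\<^sup>2 / s\<^sup>2) + 1024 * (1 / (r * s)) + 16384 * (q / s)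
      + 8192 * (D ^ 3 * k ^ 4 / r\<^sup>2 / s\<^sup>2)"
  proof -
    have "s / s\<^sup>2 = 1 / s" using s0 by (simp add: power2_eq_square)
    then have "4 * s / r / (s / 16)\<^sup>2 = 1024 * (1 / (r * s))"
      "64 * s * q / (s / 16)\<^sup>2 = 16384 * (q / s)"
      using s0 by (simp_all add: power2_eq_square)
    then show ?thesis
      by (simp add: add_divide_distrib power_divide)
  qed
  also have "\<dots> \<le> 156672 * (1 / R\<^sup>2) + 1024 * (1 / (R * C)) + 16384 * (1 / R) + 8192 * (1 / (k\<^sup>2 * D))"
    unfolding var t4 using t2 t3 by (intro add_mono order_refl mult_left_mono) auto
  finally show ?thesis
    using t1 by (simp add: r_def k_def add_divide_distrib mult.commute)
qed

section \<open>Convergence of the risk along the sequence\<close>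

theorem proposition4:
  fixes n :: "nat \<Rightarrow> nat" and p0' p1 p0 :: "nat \<Rightarrow> real" and C :: real
  defines "p0 \<equiv> \<lambda>N. null_prob N (n N) (p0' N) (p1 N)"
  assumes "\<forall>\<^sub>F N in sequentially. 0 < p0' N \<and> p0' N \<le> p1 N \<and> p1 N < 1"
    and "(\<lambda>N. real (n N) / real N) \<longlonglongrightarrow> 0"
    and "\<exists>c<1. \<forall>\<^sub>F N in sequentially. p0 N \<le> c"
    and "filterlim (\<lambda>N. (real N)\<^sup>2 * p0 N) at_top sequentially"
    and "filterlim n at_top sequentially"
    and "filterlim (\<lambda>N. (real (n N))\<^sup>2 * p1 N) at_top sequentially"
    and "C > 0"
    and "\<forall>\<^sub>F N in sequentially. p0 N \<ge> C / real N"
    and "filterlim (\<lambda>N. (p1 N - p0' N)\<^sup>2 / p0' N * (real (n N) ^ 3 / real N powr (3/2)))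
           at_top sequentially"
  shows "\<exists>t :: nat \<Rightarrow> real.
    (\<lambda>N. risk N (n N) (p0' N) (p1 N) (degree_variance_test N (t N))) \<longlonglongrightarrow> 0"
proof -
  define D where "D N = p1 N - p0' N" for N
  define s where "s N = real (n N) ^ 3 * (D N)\<^sup>2 / real N" for N
  define R where "R N = s N / (sqrt (real N) * p0 N)" for N
  \<comment> \<open>The diverging quantity of the signal hypothesis, with \<open>powr (3/2)\<close>
    resolved into a product with a square root.\<close>
  define A where "A N = (D N)\<^sup>2 / p0' N * (real (n N) ^ 3 / (real N * sqrt (real N)))" for N
  \<comment> \<open>Equal to \<open>R N / 32\<close>, a quarter of the normalised lower bound
    \<open>R N / 8\<close> for the alternative mean; this leaves room for an estimate between half
    and three halves of \<open>p0 N\<close>.\<close>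
  define t where "t N = s N / (32 * sqrt (real N) * p0 N)" for N
  define \<rho> where "\<rho> N = 32 / ((real N)\<^sup>2 * p0 N) + 156672 / (R N)\<^sup>2 + (1024 / C + 16384) / R N
    + 8192 / ((real (n N))\<^sup>2 * D N)" for N
  have ev_n: "\<forall>\<^sub>F N in sequentially. 4 \<le> n N"
    using assms(6) by (simp add: filterlim_at_top)
  have ev_ratio: "\<forall>\<^sub>F N in sequentially. 2 * n N \<le> N"
  proof -
    have "\<forall>\<^sub>F N in sequentially. real (n N) / real N < 1 / 2"
      using assms(3) by (rule order_tendstoD) simp
    then show ?thesis
      using eventually_gt_at_top[of 0] by eventually_elim (simp add: divide_less_eq)
  qed
  have "\<forall>\<^sub>F N in sequentially. (p1 N - p0' N)\<^sup>2 / p0' N * (real (n N) ^ 3 / real N powr (3/2)) = A N"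
    using eventually_gt_at_top[of 0]
  proof eventually_elim
    case (elim N)
    have "real N powr (3/2) = real N powr 1 * real N powr (1/2)"
      unfolding powr_add[symmetric] by simp
    also have "\<dots> = real N * sqrt (real N)"
      by (simp add: powr_half_sqrt)
    finally show ?case by (simp add: A_def D_def)
  qed
  then have A: "filterlim A at_top sequentially"
    using assms(10) filterlim_cong by force
  have ev_A: "\<forall>\<^sub>F N in sequentially. Z \<le> A N" for Z
    using A by (simp add: filterlim_at_top)
  have basic: "\<forall>\<^sub>F N in sequentially. 4 \<le> n N \<and> 2 * n N \<le> N \<and> 0 < p0' N \<and> p0' N \<le> p1 N \<and>
      p1 N < 1 \<and> C / real N \<le> p0 N \<and> 0 < p0 N \<and> 0 < D N"
    using ev_n ev_ratio assms(2,9) ev_A[of 1]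
  proof eventually_elim
    case (elim N)
    have "D N \<noteq> 0"
    proof
      assume "D N = 0"
      then have "A N = 0" by (simp add: A_def)
      with elim(5) show False by simp
    qed
    moreover have "0 < p0 N"
    proof -
      have "0 < C / real N" using elim(1,2) assms(8) by simp
      then show ?thesis using elim(4) by linarith
    qed
    ultimately show ?case
      using elim by (simp add: D_def)
  qed
  \<comment> \<open>Which alternative of \<open>normalized_signal_ge\<close> holds may change with
    \<open>N\<close>; both lower bounds diverge, so every \<open>Z\<close> is eventually
    passed.\<close>
  have R: "filterlim R at_top sequentially"
    unfolding filterlim_at_top
  proof
    fix Z :: real
    have "filterlim (\<lambda>N. C / 4 * sqrt (real N)) at_top sequentially"
      using assms(8)
      by (intro filterlim_tendsto_pos_mult_at_top[OF tendsto_const]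
          filterlim_compose[OF sqrt_at_top] filterlim_real_sequentially) simp
    then have "\<forall>\<^sub>F N in sequentially. Z \<le> C * sqrt (real N) / 4"
      by (simp add: filterlim_at_top)
    then show "\<forall>\<^sub>F N in sequentially. Z \<le> R N"
      using basic ev_A[of "2 * Z"]
    proof eventually_elim
      case (elim N)
      have "A N / 2 \<le> R N \<or> C * sqrt (real N) / 4 \<le> R N"
        unfolding A_def R_def s_def
        using elim assms(8)
        by (intro normalized_signal_ge[where p = "p0' N"]) (auto simp: p0_def null_prob_def D_def)
      then show ?case
        using elim by linarith
    qed
  qed
  \<comment> \<open>The same case distinction, now between \<open>A N\<close> and half of n^2
    p1.\<close>
  have nD: "filterlim (\<lambda>N. (real (n N))\<^sup>2 * D N) at_top sequentially"
    unfolding filterlim_at_top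
  proof
    fix Z :: real
    have "\<forall>\<^sub>F N in sequentially. 2 * Z \<le> (real (n N))\<^sup>2 * p1 N"
      using assms(7) by (simp only: filterlim_at_top)
    then show "\<forall>\<^sub>F N in sequentially. Z \<le> (real (n N))\<^sup>2 * D N"
      using basic ev_A[of Z]
    proof eventually_elim
      case (elim N)
      have "A N \<le> (real (n N))\<^sup>2 * D N \<or> (real (n N))\<^sup>2 * p1 N / 2 \<le> (real (n N))\<^sup>2 * D N"
        unfolding A_def D_def using elim by (intro square_times_gap_ge) auto
      then show ?case
        using elim by linarith
    qed
  qed
  have "\<rho> \<longlonglongrightarrow> 0 + 0 + 0 + 0"
    unfolding \<rho>_def
    by (intro tendsto_add real_tendsto_divide_at_top[OF tendsto_const] assms(5) R nD
        filterlim_pow_at_top) simp_all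
  then have \<rho>: "\<rho> \<longlonglongrightarrow> 0" by simp
  have "(\<lambda>N. risk N (n N) (p0' N) (p1 N) (degree_variance_test N (t N))) \<longlonglongrightarrow> 0"
  proof (rule tendsto_sandwich[OF _ _ tendsto_const \<rho>])
    show "\<forall>\<^sub>F N in sequentially.
        0 \<le> risk N (n N) (p0' N) (p1 N) (degree_variance_test N (t N))"
      using basic by eventually_elim (simp add: risk_nonneg)
    show "\<forall>\<^sub>F N in sequentially.
        risk N (n N) (p0' N) (p1 N) (degree_variance_test N (t N)) \<le> \<rho> N"
      using basic
    proof eventually_elim
      case (elim N)
      have s0: "0 < s N" using elim by (simp add: s_def)
      have "risk N (n N) (p0' N) (p1 N) (degree_variance_test N (t N)) \<le>
          8 / (num_pairs N * p0 N) + 36 * real N * (p0 N)\<^sup>2 / (s N / 64)\<^sup>2 +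
          (36 * real N * (p0 N)\<^sup>2 + 4 * s N / real N + 64 * s N * p0 N +
            32 * D N ^ 3 * real (n N) ^ 4 / (real N)\<^sup>2) / (s N / 16)\<^sup>2"
        unfolding t_def using elim s0
        by (intro risk_le) (simp_all add: D_def p0_def s_def)
      also have "\<dots> \<le> \<rho> N"
        unfolding \<rho>_def using elim assms(8)
        by (intro risk_terms_le) (auto simp: s_def R_def)
      finally show ?case .
    qed
  qed
  then show ?thesis by blast
qed

end
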